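(* For every $b>0$, $$ \lim_{\delta\to 0}\limsup_{t\to\infty}\frac 1t \log\, \mathbb P\bigg\{\sup_{x_1,x_2\in\mathbb{R}^3\colon |x_1-x_2|\leq \delta} \, \big| \Lambda_t(x_1)-\Lambda_t(x_2)\big| \geq b\bigg\}=-\infty. $$
   Context: $\mathbb P$ is the Wiener measure of a three-dimensional Brownian motion $W=(W_t)_{t\ge0}$ started at the origin. For $t>0$ and $x\in\mathbb R^3$, $\Lambda_t(x)=\frac1t\int_0^t\frac{\mathrm ds}{|W_s-x|}$ (the Coulomb potential of the normalized occupation measure $L_t=\frac1t\int_0^t\delta_{W_s}\mathrm ds$). *)

theory Defs
  imports "HOL-Probability.Probability"
begin

definition gauss3 :: "real \<Rightarrow> real^3 \<Rightarrow> real" where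
  "gauss3 v x = (2 * pi * v) powr (-3/2) * exp (- (norm x)\<^sup>2 / (2 * v))"

definition brownian_motion3 :: "'a measure \<Rightarrow> (real \<Rightarrow> 'a \<Rightarrow> real^3) \<Rightarrow> bool" where
  "brownian_motion3 M W \<longleftrightarrow>
     prob_space M \<and>
     (\<forall>t\<ge>0. W t \<in> borel_measurable M) \<and>
     (\<forall>\<omega>\<in>space M. W 0 \<omega> = 0) \<and>
     (\<forall>\<omega>\<in>space M. continuous_on {0..} (\<lambda>t. W t \<omega>)) \<and>
     (\<forall>s t. 0 \<le> s \<and> s < t \<longrightarrow>
        distributed M lborel (\<lambda>\<omega>. W t \<omega> - W s \<omega>) (\<lambda>x. ennreal (gauss3 (t - s) x))) \<and>
     (\<forall>(n::nat) (ts::nat \<Rightarrow> real). 0 \<le> ts 0 \<and> (\<forall>i<n. ts i < ts (Suc i)) \<longrightarrow>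
        prob_space.indep_vars M (\<lambda>_. borel) (\<lambda>i \<omega>. W (ts (Suc i)) \<omega> - W (ts i) \<omega>) {..<n})"

text \<open>Coulomb potential of the normalized occupation measure:
  Lambda_t(x) = (1/t) int_0^t ds / |W_s - x|.\<close>
definition Lambda :: "(real \<Rightarrow> 'a \<Rightarrow> real^3) \<Rightarrow> real \<Rightarrow> 'a \<Rightarrow> real^3 \<Rightarrow> real" where
  "Lambda W t \<omega> x = (1 / t) * (LINT s:{0..t}|lborel. 1 / norm (W s \<omega> - x))"

definition outer_prob :: "'a measure \<Rightarrow> 'a set \<Rightarrow> real" where
  "outer_prob M S = Inf {measure M A | A. A \<in> sets M \<and> S \<subseteq> A}"

definition elog :: "real \<Rightarrow> ereal" where
  "elog p = (if p > 0 then ereal (ln p) else -\<infinity>)"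

end

theory Submission
  imports Defs "HOL-Real_Asymp.Real_Asymp"
begin

text \<open>
  Cut the Coulomb kernel off at scale \<open>\<rho>\<^sup>2\<close>. The regular part \<open>1 / max |y| (\<rho>\<^sup>2)\<close> is Lipschitz with constant
  \<open>\<rho>\<^bsup>-4\<^esup>\<close>, hence harmless for small \<open>\<delta>\<close>. The singular part is dominated by a sum over the scales
  \<open>r\<^sub>k = (\<rho> / 2\<^sup>k)\<^sup>2\<close> of \<open>4 / r\<^sub>k\<close> times the occupation time of balls of radius \<open>r\<^sub>k\<close>, so it contributes at most
  \<open>8 \<rho>\<close> unless the path spends more than \<open>r\<^sub>k\<^bsup>3/2\<^esup> t\<close> in some ball of radius \<open>r\<^sub>k\<close>. Since Brownian motion
  in three dimensions is transient, the occupation time of such a ball, divided by \<open>r\<^sub>k\<^sup>2\<close>, has exponential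
  moments bounded uniformly in \<open>t\<close>, so the exceptional probability is of order
  \<open>exp (- const t / \<rho>)\<close>, which beats any prescribed exponential rate as \<open>\<rho> \<rightarrow> 0\<close>.
  The exponential moments come from an explicit Gaussian supersolution of the Feynman--Kac recursion for the
  walk observed at equidistant times; Fatou's lemma carries them over to the continuous path.
\<close>

subsection \<open>Gaussian kernels and the heat operator\<close>

lemma gauss3_nonneg [simp]: "gauss3 v x \<ge> 0"
  by (simp add: gauss3_def)

lemma borel_measurable_gauss3 [measurable]: "gauss3 v \<in> borel_measurable borel"
  unfolding gauss3_def by measurable

lemma gauss3_minus [simp]: "gauss3 v (- x) = gauss3 v x"
  by (simp add: gauss3_def)

text \<open>The squared norm splits over the coordinates, so Gaussian integrals over
  \<open>real^3\<close> reduce to one-dimensional facts about \<open>normal_density\<close>.\<close>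

lemma gauss3_eq_prod_normal_density:
  assumes "v > 0"
  shows "gauss3 v x = (\<Prod>b\<in>Basis. normal_density 0 (sqrt v) (x \<bullet> b))"
proof -
  have "(2 * pi * v) powr (-3/2) = (1 / sqrt (2 * pi * v)) ^ 3"
    using assms by (simp add: powr_minus powr_half_sqrt [symmetric] powr_powr power_one_over
        flip: powr_realpow) (simp add: divide_simps)
  moreover have "(\<Prod>b\<in>Basis. exp (- (x \<bullet> b)\<^sup>2 / (2 * v))) = exp (- (norm x)\<^sup>2 / (2 * v))"
    by (simp add: power2_norm_eq_inner euclidean_inner [of x x] sum_divide_distrib [symmetric]
        sum_negf power2_eq_square [of "_ \<bullet> _"] flip: exp_sum)
  ultimately show ?thesis
    using assms by (simp add: gauss3_def normal_density_def prod_dividef power_one_over divide_simps)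
qed

lemma nn_integral_gauss3:
  assumes "v > 0"
  shows "(\<integral>\<^sup>+x. ennreal (gauss3 v x) \<partial>lborel) = 1"
proof -
  have "(\<integral>\<^sup>+x. ennreal (gauss3 v x) \<partial>lborel)
      = (\<integral>\<^sup>+(x::real^3). (\<Prod>b\<in>Basis. ennreal (normal_density 0 (sqrt v) (x \<bullet> b))) \<partial>lborel)"
    using assms by (simp add: gauss3_eq_prod_normal_density prod_ennreal)
  also have "\<dots> = (\<Prod>b\<in>(Basis :: (real^3) set). \<integral>\<^sup>+x. ennreal (normal_density 0 (sqrt v) x) \<partial>lborel)"
    by (rule nn_integral_lborel_prod) auto
  also have "(\<integral>\<^sup>+x. ennreal (normal_density 0 (sqrt v) x) \<partial>lborel) = 1"
    using assms by (subst nn_integral_eq_integral) (auto simp: integral_normal_density)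
  finally show ?thesis by simp
qed

text \<open>In each coordinate two centred normal densities are convolved and their variances add.
  Symmetry of the density turns \<open>x + y\<close> into the difference \<open>- x - y\<close> that
  a convolution needs.\<close>

lemma gauss3_convolution:
  assumes "v > 0" "h > 0"
  shows "(\<integral>\<^sup>+y. ennreal (gauss3 v (x + y)) * ennreal (gauss3 h y) \<partial>lborel) = ennreal (gauss3 (v + h) x)"
proof -
  let ?f = "\<lambda>b y. ennreal (normal_density 0 (sqrt v) (- (x \<bullet> b) - y) * normal_density 0 (sqrt h) y)"
  have "(\<integral>\<^sup>+y. ennreal (gauss3 v (x + y)) * ennreal (gauss3 h y) \<partial>lborel)
      = (\<integral>\<^sup>+y. (\<Prod>b\<in>Basis. ?f b (y \<bullet> b)) \<partial>lborel)"
  proof (rule nn_integral_cong)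
    fix y
    have "gauss3 v (x + y) = gauss3 v (- x - y)"
      using gauss3_minus [of v "x + y"] by simp
    then have "gauss3 v (x + y) * gauss3 h y
        = (\<Prod>b\<in>Basis. normal_density 0 (sqrt v) (- (x \<bullet> b) - y \<bullet> b) * normal_density 0 (sqrt h) (y \<bullet> b))"
      using assms by (simp add: gauss3_eq_prod_normal_density inner_diff_left prod.distrib)
    then show "ennreal (gauss3 v (x + y)) * ennreal (gauss3 h y) = (\<Prod>b\<in>Basis. ?f b (y \<bullet> b))"
      by (simp add: prod_ennreal flip: ennreal_mult)
  qed
  also have "\<dots> = (\<Prod>b\<in>(Basis :: (real^3) set). \<integral>\<^sup>+y. ?f b y \<partial>lborel)"
    by (rule nn_integral_lborel_prod) auto
  also have "\<dots> = (\<Prod>b\<in>(Basis :: (real^3) set). ennreal (normal_density 0 (sqrt (v + h)) (- (x \<bullet> b))))"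
    using conv_normal_density_zero_mean [of "sqrt v" "sqrt h"] assms
    by (auto intro!: prod.cong dest: fun_cong)
  also have "\<dots> = ennreal (gauss3 (v + h) (- x))"
    using assms by (subst gauss3_eq_prod_normal_density) (auto simp: prod_ennreal)
  finally show ?thesis by simp
qed

lemma nn_integral_lborel_shift:
  fixes c :: "'a::euclidean_space"
  assumes [measurable]: "f \<in> borel_measurable borel"
  shows "(\<integral>\<^sup>+x. f (x + c) \<partial>lborel) = (\<integral>\<^sup>+x. f x \<partial>lborel)"
proof -
  have "(\<integral>\<^sup>+x. f x \<partial>lborel) = (\<integral>\<^sup>+x. f x \<partial>distr lborel borel ((+) c))"
    by (simp add: lborel_distr_plus)
  also have "\<dots> = (\<integral>\<^sup>+x. f (x + c) \<partial>lborel)"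
    by (simp add: nn_integral_distr add.commute)
  finally show ?thesis ..
qed

text \<open>For \<open>h > 0\<close> this is the Brownian semigroup at time \<open>h\<close>: the
  expectation of \<open>G\<close> at \<open>x\<close> plus a centred Gaussian step of variance
  \<open>h\<close> per coordinate. Values in \<open>ennreal\<close> avoid integrability
  conditions.\<close>

definition heat :: "real \<Rightarrow> (real^3 \<Rightarrow> ennreal) \<Rightarrow> real^3 \<Rightarrow> ennreal" where
  "heat h G x = (\<integral>\<^sup>+y. G (x + y) * ennreal (gauss3 h y) \<partial>lborel)"

lemma borel_measurable_heat [measurable]:
  assumes [measurable]: "G \<in> borel_measurable borel"
  shows "heat h G \<in> borel_measurable borel"
  unfolding heat_def by measurable

lemma heat_mono: "(\<And>x. F x \<le> G x) \<Longrightarrow> heat h F x \<le> heat h G x"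
  unfolding heat_def by (intro nn_integral_mono mult_right_mono) auto

lemma heat_const: "h > 0 \<Longrightarrow> heat h (\<lambda>_. c) x = c"
  by (simp add: heat_def nn_integral_cmult nn_integral_gauss3)

lemma heat_add:
  assumes [measurable]: "F \<in> borel_measurable borel" "G \<in> borel_measurable borel"
  shows "heat h (\<lambda>x. F x + G x) x = heat h F x + heat h G x"
  by (simp add: heat_def distrib_right nn_integral_add)

lemma heat_cmult:
  assumes [measurable]: "F \<in> borel_measurable borel"
  shows "heat h (\<lambda>x. c * F x) x = c * heat h F x"
  by (simp add: heat_def mult.assoc nn_integral_cmult)

lemma heat_sum:
  assumes [measurable]: "\<And>i. i \<in> I \<Longrightarrow> F i \<in> borel_measurable borel"
  shows "heat h (\<lambda>x. \<Sum>i\<in>I. F i x) x = (\<Sum>i\<in>I. heat h (F i) x)"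
  by (simp add: heat_def sum_distrib_right nn_integral_sum)

lemma heat_gauss3:
  "v > 0 \<Longrightarrow> h > 0 \<Longrightarrow> heat h (\<lambda>x. ennreal (gauss3 v x)) x = ennreal (gauss3 (v + h) x)"
  by (simp add: heat_def gauss3_convolution)

text \<open>Tonelli and translation invariance. This conservation of mass is what allows integrating
  over the starting point in \<open>fk_step_excess_integral\<close>.\<close>

lemma nn_integral_heat:
  assumes [measurable]: "G \<in> borel_measurable borel" and "h > 0"
  shows "(\<integral>\<^sup>+x. heat h G x \<partial>lborel) = (\<integral>\<^sup>+x. G x \<partial>lborel)"
proof -
  have "(\<integral>\<^sup>+x. heat h G x \<partial>lborel)
      = (\<integral>\<^sup>+y. \<integral>\<^sup>+x. G (x + y) * ennreal (gauss3 h y) \<partial>lborel \<partial>lborel)"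
    unfolding heat_def by (rule lborel_pair.Fubini') measurable
  also have "\<dots> = (\<integral>\<^sup>+y. (\<integral>\<^sup>+x. G x \<partial>lborel) * ennreal (gauss3 h y) \<partial>lborel)"
    by (simp add: nn_integral_multc nn_integral_lborel_shift)
  also have "\<dots> = (\<integral>\<^sup>+x. G x \<partial>lborel)"
    using assms by (simp add: nn_integral_cmult nn_integral_gauss3)
  finally show ?thesis .
qed

subsection \<open>Exponential moments of occupation times\<close>

text \<open>The transfer operator of the Gaussian random walk with weight \<open>1 + m\<close> collected at the
  current position (a time-discrete Feynman--Kac semigroup).\<close>

definition fk_step :: "real \<Rightarrow> (real^3 \<Rightarrow> ennreal) \<Rightarrow> (real^3 \<Rightarrow> ennreal) \<Rightarrow> real^3 \<Rightarrow> ennreal" where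
  "fk_step h m G x = (1 + m x) * heat h G x"

lemma borel_measurable_fk_step [measurable]:
  assumes [measurable]: "m \<in> borel_measurable borel" "G \<in> borel_measurable borel"
  shows "fk_step h m G \<in> borel_measurable borel"
  unfolding fk_step_def by measurable

lemma borel_measurable_fk_step_pow:
  assumes [measurable]: "m \<in> borel_measurable borel" "G \<in> borel_measurable borel"
  shows "(fk_step h m ^^ n) G \<in> borel_measurable borel"
  by (induction n) (auto intro!: borel_measurable_fk_step)

definition gauss_measure :: "real \<Rightarrow> (real^3) measure" where
  "gauss_measure h = density lborel (\<lambda>x. ennreal (gauss3 h x))"

lemma sets_gauss_measure [measurable_cong, simp]: "sets (gauss_measure h) = sets borel"
  by (simp add: gauss_measure_def)

lemma space_gauss_measure [simp]: "space (gauss_measure h) = UNIV"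
  by (simp add: gauss_measure_def)

lemma prob_space_gauss_measure: "h > 0 \<Longrightarrow> prob_space (gauss_measure h)"
  by (rule prob_spaceI) (simp add: gauss_measure_def emeasure_density nn_integral_gauss3)

lemma nn_integral_gauss_measure:
  assumes [measurable]: "f \<in> borel_measurable borel"
  shows "(\<integral>\<^sup>+y. f y \<partial>gauss_measure h) = (\<integral>\<^sup>+y. f y * ennreal (gauss3 h y) \<partial>lborel)"
  by (simp add: gauss_measure_def nn_integral_density mult.commute)

text \<open>The last increment enters only through the argument of \<open>G\<close>, because the
  weights stop one position before the endpoint. Integrating it out replaces \<open>G\<close> by
  \<open>fk_step h m G\<close>, hence the induction over arbitrary \<open>G\<close>.\<close>

lemma nn_integral_walk_eq_fk_step:
  assumes [measurable]: "m \<in> borel_measurable borel" "G \<in> borel_measurable borel" and "h > 0"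
  shows "(\<integral>\<^sup>+\<xi>. (\<Prod>j<n. 1 + m (x + (\<Sum>i<j. \<xi> i))) * G (x + (\<Sum>i<n. \<xi> i))
            \<partial>PiM {..<n} (\<lambda>_. gauss_measure h)) = (fk_step h m ^^ n) G x"
  using assms(2)
proof (induction n arbitrary: G)
  case 0
  interpret product_sigma_finite "\<lambda>_. gauss_measure h"
    using prob_space_gauss_measure [OF \<open>h > 0\<close>]
    by (simp add: product_sigma_finite_def prob_space_imp_sigma_finite)
  show ?case by (simp add: PiM_empty nn_integral_count_space_finite)
next
  case (Suc n)
  note [measurable] = \<open>G \<in> borel_measurable borel\<close>
  interpret product_sigma_finite "\<lambda>_. gauss_measure h"
    using prob_space_gauss_measure [OF \<open>h > 0\<close>]
    by (simp add: product_sigma_finite_def prob_space_imp_sigma_finite)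
  let ?P = "\<lambda>n \<xi>. \<Prod>j<n. 1 + m (x + (\<Sum>i<j. \<xi> i))"
  have "(\<integral>\<^sup>+\<xi>. ?P (Suc n) \<xi> * G (x + (\<Sum>i<Suc n. \<xi> i)) \<partial>PiM {..<Suc n} (\<lambda>_. gauss_measure h))
      = (\<integral>\<^sup>+\<xi>. \<integral>\<^sup>+y. ?P (Suc n) (\<xi>(n := y)) * G (x + (\<Sum>i<Suc n. (\<xi>(n := y)) i))
            \<partial>gauss_measure h \<partial>PiM {..<n} (\<lambda>_. gauss_measure h))"
    unfolding lessThan_Suc
    by (rule product_nn_integral_insert) (auto simp flip: lessThan_Suc intro!: borel_measurable_times_ennreal
        borel_measurable_prod_ennreal measurable_compose [OF _ assms(1)] measurable_compose [OF _ Suc.prems]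
        borel_measurable_add borel_measurable_sum measurable_component_singleton)
  also have "\<dots> = (\<integral>\<^sup>+\<xi>. ?P n \<xi> * fk_step h m G (x + (\<Sum>i<n. \<xi> i))
            \<partial>PiM {..<n} (\<lambda>_. gauss_measure h))"
  proof (rule nn_integral_cong)
    fix \<xi> :: "nat \<Rightarrow> real^3"
    have "(\<Sum>i<j. (\<xi>(n := y)) i) = (\<Sum>i<j. \<xi> i)" if "j \<le> n" for j y
      using that by (intro sum.cong) auto
    then have P: "?P (Suc n) (\<xi>(n := y)) = ?P n \<xi> * (1 + m (x + (\<Sum>i<n. \<xi> i)))" for y
      by (simp add: prod.lessThan_Suc)
    have G: "G (x + (\<Sum>i<Suc n. (\<xi>(n := y)) i)) = G ((x + (\<Sum>i<n. \<xi> i)) + y)" for y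
      by (simp add: add.assoc)
    show "(\<integral>\<^sup>+y. ?P (Suc n) (\<xi>(n := y)) * G (x + (\<Sum>i<Suc n. (\<xi>(n := y)) i)) \<partial>gauss_measure h)
        = ?P n \<xi> * fk_step h m G (x + (\<Sum>i<n. \<xi> i))"
      unfolding P G by (simp add: nn_integral_cmult nn_integral_gauss_measure fk_step_def heat_def mult.assoc)
  qed
  also have "\<dots> = (fk_step h m ^^ n) (fk_step h m G) x"
    by (rule Suc.IH) measurable
  finally show ?case by (simp add: funpow_swap1)
qed

lemma exp_minus_one_le:
  fixes y :: real
  assumes "0 \<le> y" "y \<le> 1"
  shows "exp y - 1 \<le> 2 * y"
  using exp_bound [OF assms] mult_left_mono [of y 1 y] assms by (simp add: power2_eq_square)

text \<open>Rewrites the exponential of an additive functional as a product of weights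
  \<open>1 + m\<close>, the form in which \<open>fk_step\<close> collects them.\<close>

lemma ennreal_exp_sum_eq_prod:
  assumes "\<And>i. i \<in> I \<Longrightarrow> 0 \<le> f i"
  shows "ennreal (exp (\<Sum>i\<in>I. f i)) = (\<Prod>i\<in>I. 1 + ennreal (exp (f i) - 1))"
proof (cases "finite I")
  case True
  have "ennreal (exp (f i)) = 1 + ennreal (exp (f i) - 1)" if "i \<in> I" for i
    using assms [OF that] by (simp add: ennreal_plus [symmetric] del: ennreal_plus flip: ennreal_1)
  then show ?thesis
    using True by (simp add: exp_sum prod_ennreal [symmetric])
qed auto

text \<open>A smooth substitute for the indicator of a ball of radius \<open>r\<close>, chosen
  Gaussian because the heat operator only increases the variance. The constant 24 dominates the
  3/2-th power of 2 pi in the total mass and makes the weight small enough for exponential moments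
  below 2.\<close>

definition bump :: "real \<Rightarrow> real^3 \<Rightarrow> real" where
  "bump r x = exp (- (norm x)\<^sup>2 / (2 * r\<^sup>2)) / (24 * r\<^sup>2)"

lemma bump_nonneg [simp]: "0 \<le> bump r x"
  by (simp add: bump_def)

lemma continuous_on_bump [continuous_intros]:
  assumes "continuous_on S f"
  shows "continuous_on S (\<lambda>s. bump r (f s))"
proof (cases "r = 0")
  case False
  then show ?thesis
    unfolding bump_def by (intro continuous_intros assms) auto
qed (simp add: bump_def)

lemma borel_measurable_bump [measurable]: "bump r \<in> borel_measurable borel"
  unfolding bump_def by measurable

lemma exp_bump_minus_one_le:
  assumes "r > 0" "0 < h" "h \<le> r\<^sup>2"
  shows "exp (h * bump r x) - 1 \<le> 2 * (h * bump r x)"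
proof -
  have "bump r x \<le> 1 / (24 * r\<^sup>2)"
    unfolding bump_def using assms by (intro divide_right_mono) auto
  then have "h * bump r x \<le> r\<^sup>2 * (1 / (24 * r\<^sup>2))"
    using assms by (intro mult_mono) auto
  then show ?thesis
    using assms by (intro exp_minus_one_le) auto
qed

lemma bump_eq_gauss3:
  assumes "r > 0"
  shows "bump r x = (2 * pi * r\<^sup>2) powr (3/2) * gauss3 (r\<^sup>2) x / (24 * r\<^sup>2)"
  using assms by (simp add: bump_def gauss3_def powr_minus)

lemma powr_three_halves: "x > 0 \<Longrightarrow> x powr (3/2) = (sqrt x) ^ 3"
  by (simp add: powr_half_sqrt [symmetric] powr_powr flip: powr_realpow)

lemma nn_integral_bump_le:
  assumes "r > 0"
  shows "(\<integral>\<^sup>+x. ennreal (bump r x) \<partial>lborel) \<le> ennreal r"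
proof -
  have "sqrt (2 * pi) \<le> 3"
    using pi_less_4 by (intro real_le_lsqrt) auto
  \<comment> \<open>Two of the factors are bounded together by \<open>2 * pi \<le> 8\<close> and the
    third by 3; bounding each by 3 would only give 27.\<close>
  then have "sqrt (2 * pi) ^ 3 \<le> 24"
    using pi_less_4 mult_mono [of "2 * pi" 8 "sqrt (2 * pi)" 3]
    by (simp add: power3_eq_cube real_sqrt_mult_self)
  then have "(2 * pi * r\<^sup>2) powr (3/2) \<le> 24 * r ^ 3"
    using assms by (simp add: powr_three_halves real_sqrt_mult power_mult_distrib)
  then have le: "(2 * pi * r\<^sup>2) powr (3/2) / (24 * r\<^sup>2) \<le> r"
    using assms by (simp add: divide_simps power3_eq_cube power2_eq_square)
  have "(\<integral>\<^sup>+x. ennreal (bump r x) \<partial>lborel)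
      = (\<integral>\<^sup>+x. ennreal ((2 * pi * r\<^sup>2) powr (3/2) / (24 * r\<^sup>2)) * ennreal (gauss3 (r\<^sup>2) x) \<partial>lborel)"
    using assms by (simp add: bump_eq_gauss3 flip: ennreal_mult)
  also have "\<dots> = ennreal ((2 * pi * r\<^sup>2) powr (3/2) / (24 * r\<^sup>2))"
    using assms by (simp add: nn_integral_cmult nn_integral_gauss3)
  finally show ?thesis
    using le by (simp add: ennreal_leI)
qed

text \<open>A Gaussian density is largest at its centre, and there the two normalizing constants
  leave the cube of the ratio of standard deviations.\<close>

lemma gauss3_le:
  assumes "r > 0" "s \<ge> 0"
  shows "(2 * pi * r\<^sup>2) powr (3/2) * gauss3 (r\<^sup>2 + s) x \<le> (r / sqrt (r\<^sup>2 + s)) ^ 3"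
proof -
  have pos: "r\<^sup>2 + s > 0"
    using assms by (simp add: add_pos_nonneg)
  have "(2 * pi * r\<^sup>2) powr (3/2) * (2 * pi * (r\<^sup>2 + s)) powr (-3/2) = (r / sqrt (r\<^sup>2 + s)) ^ 3"
    using assms pos
    by (simp add: powr_minus powr_three_halves real_sqrt_mult power_mult_distrib power_divide divide_simps)
  moreover have "exp (- (norm x)\<^sup>2 / (2 * (r\<^sup>2 + s))) \<le> 1"
    using pos by simp
  ultimately show ?thesis
    unfolding gauss3_def using assms
    by (smt (verit) mult.assoc mult_left_le zero_le_power divide_nonneg_nonneg real_sqrt_ge_zero pos)
qed

text \<open>The transience of the walk: the sum is a Riemann sum of
  \<open>\<integral>\<^sub>0\<^sup>\<infinity> (r\<^sup>2 / (r\<^sup>2 + s))\<^bsup>3/2\<^esup> ds = 2 r\<^sup>2\<close>.\<close>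

lemma sum_inverse_cube_le:
  assumes "r > 0" "0 < h" "h \<le> r\<^sup>2"
  shows "(\<Sum>j<n. h * (r / sqrt (r\<^sup>2 + real j * h)) ^ 3) \<le> 3 * r\<^sup>2"
proof -
  \<comment> \<open>The subtracted term is the tail of the integral, which makes the induction
    telescope: each new summand, taken at the right endpoint of its interval, is at most the
    decrease of the tail. The summand \<open>j = 0\<close> lies outside this comparison and costs
    \<open>h \<le> r\<^sup>2\<close>, whence 3 instead of 2.\<close>
  have *: "(\<Sum>j<Suc n. h * (r / sqrt (r\<^sup>2 + real j * h)) ^ 3) \<le> 3 * r\<^sup>2 - 2 * r ^ 3 / sqrt (r\<^sup>2 + real n * h)"
    for n
  proof (induction n)
    case 0
    then show ?case
      using assms by (simp add: power3_eq_cube power2_eq_square)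
  next
    case (Suc n)
    define a where "a = sqrt (r\<^sup>2 + real n * h)"
    define b where "b = sqrt (r\<^sup>2 + real (Suc n) * h)"
    have pos: "r\<^sup>2 + real n * h > 0" "r\<^sup>2 + real (Suc n) * h > 0"
      using assms by (auto intro!: add_pos_nonneg)
    have ab: "0 < a" "a \<le> b" "0 < b"
      unfolding a_def b_def using assms pos by auto
    have "b\<^sup>2 - a\<^sup>2 = h"
      unfolding a_def b_def using assms pos by (simp add: algebra_simps)
    then have h: "h = (b - a) * (b + a)"
      by (simp add: power2_eq_square algebra_simps)
    have "(b + a) * a \<le> (2 * b) * b"
      using ab by (intro mult_mono) auto
    then have "(b - a) * ((b + a) * a) \<le> (b - a) * ((2 * b) * b)"
      using ab by (intro mult_left_mono) auto
    then have "h / b ^ 3 \<le> 2 / a - 2 / b"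
      using ab unfolding h by (simp add: divide_simps power3_eq_cube) (simp add: algebra_simps)
    then have "h * (r / b) ^ 3 \<le> 2 * r ^ 3 / a - 2 * r ^ 3 / b"
      using assms mult_left_mono [of "h / b ^ 3" "2 / a - 2 / b" "r ^ 3"]
      by (simp add: power_divide algebra_simps)
    with Suc.IH show ?case
      unfolding sum.lessThan_Suc [of _ "Suc n"] by (fold a_def b_def) linarith
  qed
  show ?thesis
  proof (cases n)
    case (Suc k)
    have "0 \<le> 2 * r ^ 3 / sqrt (r\<^sup>2 + real k * h)"
      using assms by simp
    with * [of k] show ?thesis
      unfolding Suc by linarith
  qed simp
qed

text \<open>The \<open>n\<close>-step Green potential of the bump gives a supersolution \<open>u\<close> of the Feynman--Kac
  recursion, since applying the heat operator to it only drops the summand for time \<open>0\<close>.\<close>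

lemma fk_step_bump_le_two:
  assumes "r > 0" "0 < h" "h \<le> r\<^sup>2"
  defines "m \<equiv> \<lambda>x. ennreal (exp (h * bump r x) - 1)"
  shows "(fk_step h m ^^ n) (\<lambda>_. 1) x \<le> 2"
proof -
  \<comment> \<open>\<open>w j\<close> is \<open>w 0\<close> after \<open>j\<close> heat steps,
    since each step adds \<open>h\<close> to the variance. The prefactor normalizes the total of all
    \<open>w j\<close> to at most 1, so \<open>u\<close> stays between 1 and 2.\<close>
  define w where "w j x = h / (3 * r\<^sup>2) * ((2 * pi * r\<^sup>2) powr (3/2) * gauss3 (r\<^sup>2 + real j * h) x)" for j x
  define u where "u n x = 1 + (\<Sum>j<n. ennreal (w j x))" for n x
  have w_nonneg: "0 \<le> w j x" for j x
    using assms by (simp add: w_def)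
  have [measurable]: "w j \<in> borel_measurable borel" for j
    unfolding w_def by measurable
  have u_le: "u n x \<le> 2" for n x
  proof -
    have "(\<Sum>j<n. w j x) \<le> (\<Sum>j<n. 1 / (3 * r\<^sup>2) * (h * (r / sqrt (r\<^sup>2 + real j * h)) ^ 3))"
    proof (rule sum_mono)
      fix j
      show "w j x \<le> 1 / (3 * r\<^sup>2) * (h * (r / sqrt (r\<^sup>2 + real j * h)) ^ 3)"
        using mult_left_mono [OF gauss3_le [of r "real j * h" x], of "h / (3 * r\<^sup>2)"] assms
        by (simp add: w_def)
    qed
    also have "\<dots> = 1 / (3 * r\<^sup>2) * (\<Sum>j<n. h * (r / sqrt (r\<^sup>2 + real j * h)) ^ 3)"
      by (simp only: sum_distrib_left)
    also have "\<dots> \<le> 1 / (3 * r\<^sup>2) * (3 * r\<^sup>2)"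
      by (intro mult_left_mono sum_inverse_cube_le assms) simp
    also have "\<dots> = 1"
      using assms by simp
    finally have "(\<Sum>j<n. ennreal (w j x)) \<le> 1"
      by (simp add: sum_ennreal w_nonneg)
    then show ?thesis
      unfolding u_def by (metis add_left_mono one_add_one)
  qed
  have heat_u: "heat h (u n) x + ennreal (w 0 x) = u (Suc n) x" for n x
  proof -
    have w_eq: "ennreal (w j y) = ennreal (h / (3 * r\<^sup>2) * (2 * pi * r\<^sup>2) powr (3/2))
        * ennreal (gauss3 (r\<^sup>2 + real j * h) y)" for j y
      using assms by (simp add: w_def mult.assoc flip: ennreal_mult)
    have "heat h (\<lambda>x. ennreal (w j x)) x = ennreal (w (Suc j) x)" for j
    proof -
      have "r\<^sup>2 + real j * h > 0"
        using assms(1,2) by (simp add: add_pos_nonneg)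
      then have "heat h (\<lambda>x. ennreal (gauss3 (r\<^sup>2 + real j * h) x)) x
          = ennreal (gauss3 (r\<^sup>2 + real j * h + h) x)"
        using assms(2) by (rule heat_gauss3)
      also have "r\<^sup>2 + real j * h + h = r\<^sup>2 + real (Suc j) * h"
        by (simp add: distrib_right)
      finally have *: "ennreal (gauss3 (r\<^sup>2 + real (Suc j) * h) x)
          = heat h (\<lambda>x. ennreal (gauss3 (r\<^sup>2 + real j * h) x)) x" ..
      show ?thesis
        unfolding w_eq * by (rule heat_cmult) measurable
    qed
    moreover have "heat h (u n) x = 1 + (\<Sum>j<n. heat h (\<lambda>x. ennreal (w j x)) x)"
      unfolding u_def [abs_def] using assms by (simp add: heat_add heat_const heat_sum)
    ultimately have "heat h (u n) x = 1 + (\<Sum>j<n. ennreal (w (Suc j) x))"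
      by (simp only:)
    moreover have "(\<Sum>j<Suc n. ennreal (w j x)) = ennreal (w 0 x) + (\<Sum>j<n. ennreal (w (Suc j) x))"
      by (rule sum.lessThan_Suc_shift)
    ultimately show ?thesis
      by (simp only: u_def [of "Suc n"] ac_simps)
  qed
  \<comment> \<open>The factor 2 is the bound on \<open>heat h (u n)\<close>: the weight collected
    in one step is paid for by the summand \<open>w 0\<close>, which equals
    \<open>8 * h * bump r x\<close>.\<close>
  have m_le: "m x * 2 \<le> ennreal (w 0 x)" for x
  proof -
    have "exp (h * bump r x) - 1 \<le> 2 * (h * bump r x)"
      using assms(1-3) by (intro exp_bump_minus_one_le) auto
    also have "\<dots> = w 0 x / 4"
      using assms by (simp add: w_def bump_eq_gauss3)
    finally have "(exp (h * bump r x) - 1) * 2 \<le> w 0 x"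
      using w_nonneg [of 0 x] by simp
    then show ?thesis
      using assms by (simp add: m_def ennreal_mult'' [symmetric] ennreal_leI flip: ennreal_numeral)
  qed
  have "(fk_step h m ^^ n) (\<lambda>_. 1) x \<le> u n x"
  proof (induction n arbitrary: x)
    case 0
    then show ?case by (simp add: u_def)
  next
    case (Suc n)
    have "(fk_step h m ^^ Suc n) (\<lambda>_. 1) x \<le> fk_step h m (u n) x"
      by (auto simp: fk_step_def intro!: mult_left_mono heat_mono Suc.IH)
    also have "\<dots> = heat h (u n) x + m x * heat h (u n) x"
      by (simp add: fk_step_def distrib_right)
    also have "\<dots> \<le> heat h (u n) x + m x * 2"
      using heat_mono [of "u n" "\<lambda>_. 2" h x] u_le heat_const [OF \<open>0 < h\<close>, of 2 x]
      by (intro add_left_mono mult_left_mono) auto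
    also have "\<dots> \<le> u (Suc n) x"
      unfolding heat_u [symmetric] by (intro add_left_mono m_le)
    finally show ?case .
  qed
  then show ?thesis
    using u_le by (rule order_trans)
qed

text \<open>Only the excess over 1 can be integrated over all of space. One step transports the old
  excess by the heat operator, which preserves its integral, and adds at most \<open>C * m\<close>.
  The witness \<open>Q\<close> avoids subtraction in \<open>ennreal\<close>.\<close>

lemma fk_step_excess_integral:
  assumes [measurable]: "m \<in> borel_measurable borel" and "h > 0"
    and bound: "\<And>n x. (fk_step h m ^^ n) (\<lambda>_. 1) x \<le> C"
  shows "\<exists>Q \<in> borel_measurable borel. (\<forall>x. (fk_step h m ^^ n) (\<lambda>_. 1) x = 1 + Q x) \<and>
           (\<integral>\<^sup>+x. Q x \<partial>lborel) \<le> of_nat n * (C * (\<integral>\<^sup>+x. m x \<partial>lborel))"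
proof (induction n)
  case 0
  then show ?case by (intro bexI [of _ "\<lambda>_. 0"]) auto
next
  case (Suc n)
  let ?F = "\<lambda>n. (fk_step h m ^^ n) (\<lambda>_. 1)"
  from Suc obtain Q where [measurable]: "Q \<in> borel_measurable borel"
    and Q: "\<And>x. ?F n x = 1 + Q x"
    and int: "(\<integral>\<^sup>+x. Q x \<partial>lborel) \<le> of_nat n * (C * (\<integral>\<^sup>+x. m x \<partial>lborel))"
    by blast
  have [measurable]: "?F n \<in> borel_measurable borel"
    by (intro borel_measurable_fk_step_pow) auto
  have heat_F: "heat h (?F n) x = 1 + heat h Q x" for x
    using \<open>h > 0\<close> by (simp add: Q [THEN ext] heat_add heat_const)
  let ?Q = "\<lambda>x. m x * heat h (?F n) x + heat h Q x"
  have "?F (Suc n) x = 1 + ?Q x" for x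
    by (simp add: fk_step_def distrib_right heat_F add_ac)
  moreover have "(\<integral>\<^sup>+x. ?Q x \<partial>lborel) \<le> of_nat (Suc n) * (C * (\<integral>\<^sup>+x. m x \<partial>lborel))"
  proof -
    have "heat h (?F n) x \<le> C" for x
      using heat_mono [of "?F n" "\<lambda>_. C" h x] bound heat_const [OF \<open>h > 0\<close>, of C x] by simp
    then have "(\<integral>\<^sup>+x. m x * heat h (?F n) x \<partial>lborel) \<le> (\<integral>\<^sup>+x. C * m x \<partial>lborel)"
      by (intro nn_integral_mono) (metis mult.commute mult_left_mono zero_le)
    also have "\<dots> = C * (\<integral>\<^sup>+x. m x \<partial>lborel)"
      by (simp add: nn_integral_cmult)
    finally show ?thesis
      using int \<open>h > 0\<close>
      by (simp add: nn_integral_add nn_integral_heat distrib_right add_mono)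
  qed
  ultimately show ?case
    by (intro bexI [of _ ?Q]) auto
qed

section \<open>Brownian motion observed at equidistant times\<close>

lemma brownian_motion3D:
  assumes "brownian_motion3 M W"
  shows "prob_space M" "t \<ge> 0 \<Longrightarrow> W t \<in> borel_measurable M"
    "\<omega> \<in> space M \<Longrightarrow> W 0 \<omega> = 0" "\<omega> \<in> space M \<Longrightarrow> continuous_on {0..} (\<lambda>t. W t \<omega>)"
  using assms by (auto simp: brownian_motion3_def)

lemma brownian_motion3_distributed:
  assumes "brownian_motion3 M W" "0 \<le> s" "s < t"
  shows "distributed M lborel (\<lambda>\<omega>. W t \<omega> - W s \<omega>) (\<lambda>x. ennreal (gauss3 (t - s) x))"
  using assms by (simp add: brownian_motion3_def)

lemma brownian_motion3_indep:
  fixes ts :: "nat \<Rightarrow> real"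
  assumes "brownian_motion3 M W" "0 \<le> ts 0" "\<And>i. i < n \<Longrightarrow> ts i < ts (Suc i)"
  shows "prob_space.indep_vars M (\<lambda>_. borel) (\<lambda>i \<omega>. W (ts (Suc i)) \<omega> - W (ts i) \<omega>) {..<n}"
  using assms by (simp add: brownian_motion3_def)

text \<open>Independence makes the joint law a product, and equal time steps make all factors the
  same Gaussian. The characterization of independence by product laws asks for a nonempty index set,
  hence \<open>n > 0\<close>.\<close>

lemma brownian_motion3_distr_increments:
  assumes "brownian_motion3 M W" "h > 0" "n > 0"
  shows "distr M (PiM {..<n} (\<lambda>_. borel)) (\<lambda>\<omega>. \<lambda>i\<in>{..<n}. W (real (Suc i) * h) \<omega> - W (real i * h) \<omega>)
      = PiM {..<n} (\<lambda>_. gauss_measure h)"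
proof -
  interpret prob_space M
    by (rule brownian_motion3D [OF assms(1)])
  let ?X = "\<lambda>i \<omega>. W (real (Suc i) * h) \<omega> - W (real i * h) \<omega>"
  have rv [measurable]: "?X i \<in> borel_measurable M" for i
    using assms(2) by (intro borel_measurable_diff brownian_motion3D [OF assms(1)]) auto
  have distr: "distr M borel (?X i) = gauss_measure h" for i
  proof -
    have "distributed M lborel (?X i) (\<lambda>x. ennreal (gauss3 (real (Suc i) * h - real i * h) x))"
      using assms by (intro brownian_motion3_distributed) auto
    then have "distr M lborel (?X i) = gauss_measure h"
      by (simp add: distributed_def gauss_measure_def algebra_simps)
    then show ?thesis
      by (simp cong: distr_cong)
  qed
  have "indep_vars (\<lambda>_. borel) ?X {..<n}"
    using assms by (intro brownian_motion3_indep [of M W "\<lambda>i. real i * h"]) auto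
  then have "distr M (PiM {..<n} (\<lambda>_. borel)) (\<lambda>\<omega>. \<lambda>i\<in>{..<n}. ?X i \<omega>)
      = PiM {..<n} (\<lambda>i. distr M borel (?X i))"
    by (rule indep_vars_iff_distr_eq_PiM [THEN iffD1, OF _ rv, rotated]) (use \<open>n > 0\<close> in auto)
  then show ?thesis
    unfolding distr .
qed

text \<open>The increments telescope to the position because the path starts at 0, so the
  expectation is the product-measure integral of the Gaussian walk with
  \<open>G = 1\<close>.\<close>

lemma brownian_motion3_feynman_kac:
  assumes "brownian_motion3 M W" "h > 0" and [measurable]: "m \<in> borel_measurable borel"
  shows "(\<integral>\<^sup>+\<omega>. (\<Prod>j<n. 1 + m (x + W (real j * h) \<omega>)) \<partial>M) = (fk_step h m ^^ n) (\<lambda>_. 1) x"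
proof (cases "n = 0")
  case True
  then show ?thesis
    using prob_space.emeasure_space_1 [OF brownian_motion3D(1) [OF assms(1)]] by simp
next
  case False
  interpret prob_space M
    by (rule brownian_motion3D [OF assms(1)])
  let ?X = "\<lambda>i \<omega>. W (real (Suc i) * h) \<omega> - W (real i * h) \<omega>"
  have rv [measurable]: "?X i \<in> borel_measurable M" for i
    using assms(2) by (intro borel_measurable_diff brownian_motion3D [OF assms(1)]) auto
  have X: "(\<Sum>i<j. (\<lambda>i\<in>{..<n}. ?X i \<omega>) i) = W (real j * h) \<omega>" if "\<omega> \<in> space M" "j < n" for \<omega> j
  proof -
    have "(\<Sum>i<j. (\<lambda>i\<in>{..<n}. ?X i \<omega>) i) = (\<Sum>i<j. ?X i \<omega>)"
      using that by (intro sum.cong) auto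
    then show ?thesis
      using that sum_lessThan_telescope [of "\<lambda>i. W (real i * h) \<omega>" j]
      by (simp add: brownian_motion3D(3) [OF assms(1)])
  qed
  have "(fk_step h m ^^ n) (\<lambda>_. 1) x
      = (\<integral>\<^sup>+\<xi>. (\<Prod>j<n. 1 + m (x + (\<Sum>i<j. \<xi> i))) * 1 \<partial>PiM {..<n} (\<lambda>_. gauss_measure h))"
    using assms by (subst nn_integral_walk_eq_fk_step) auto
  also have "\<dots> = (\<integral>\<^sup>+\<xi>. (\<Prod>j<n. 1 + m (x + (\<Sum>i<j. \<xi> i)))
      \<partial>distr M (PiM {..<n} (\<lambda>_. borel)) (\<lambda>\<omega>. \<lambda>i\<in>{..<n}. ?X i \<omega>))"
    using False by (simp only: mult_1_right brownian_motion3_distr_increments [OF assms(1,2)] neq0_conv)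
  also have "\<dots> = (\<integral>\<^sup>+\<omega>. (\<Prod>j<n. 1 + m (x + (\<Sum>i<j. (\<lambda>i\<in>{..<n}. ?X i \<omega>) i))) \<partial>M)"
    by (rule nn_integral_distr) (auto intro!: borel_measurable_prod_ennreal borel_measurable_add
        measurable_compose [OF _ assms(3)] borel_measurable_sum measurable_component_singleton measurable_restrict simp del: of_nat_Suc)
  also have "\<dots> = (\<integral>\<^sup>+\<omega>. (\<Prod>j<n. 1 + m (x + W (real j * h) \<omega>)) \<partial>M)"
    by (intro nn_integral_cong prod.cong arg_cong2 [of _ _ _ _ "(+)"] arg_cong [of _ _ m] X refl) auto
  finally show ?thesis ..
qed

lemma brownian_motion3_riemann_exp_measurable:
  assumes "brownian_motion3 M W" "0 \<le> h"
  shows "(\<lambda>(\<omega>, x). ennreal (exp (\<Sum>j<n. h * bump r (x + W (real j * h) \<omega>)) - 1))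
           \<in> borel_measurable (M \<Otimes>\<^sub>M lborel)"
proof -
  have [measurable]: "W (real j * h) \<in> borel_measurable M" for j
    using assms by (intro brownian_motion3D [OF assms(1)]) auto
  show ?thesis
    by measurable
qed

text \<open>Integrating over the starting point \<open>x\<close> replaces a supremum over \<open>x\<close>: no bound on the range of
  the path is needed, because \<open>exp - 1\<close> vanishes where the path does not come near.\<close>

lemma brownian_motion3_riemann_exp_moment:
  assumes "brownian_motion3 M W" "r > 0" "0 < h" "h \<le> r\<^sup>2"
  shows "(\<integral>\<^sup>+\<omega>. \<integral>\<^sup>+x. ennreal (exp (\<Sum>j<n. h * bump r (x + W (real j * h) \<omega>)) - 1) \<partial>lborel \<partial>M)
           \<le> ennreal (4 * (real n * h) * r)"
proof -
  interpret prob_space M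
    by (rule brownian_motion3D [OF assms(1)])
  have [measurable]: "W (real j * h) \<in> borel_measurable M" for j
    using assms(3) by (intro brownian_motion3D [OF assms(1)]) auto
  let ?f = "\<lambda>\<omega> x. ennreal (exp (\<Sum>j<n. h * bump r (x + W (real j * h) \<omega>)) - 1)"
  have f [measurable]: "(\<lambda>(\<omega>, x). ?f \<omega> x) \<in> borel_measurable (M \<Otimes>\<^sub>M lborel)"
    using assms by (intro brownian_motion3_riemann_exp_measurable) auto
  define m where "m x = ennreal (exp (h * bump r x) - 1)" for x
  have [measurable]: "m \<in> borel_measurable borel"
    unfolding m_def by measurable
  have int_m: "(\<integral>\<^sup>+x. m x \<partial>lborel) \<le> ennreal (2 * h * r)"
  proof -
    have "m x \<le> ennreal (2 * h) * ennreal (bump r x)" for x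
    proof -
      have "exp (h * bump r x) - 1 \<le> 2 * (h * bump r x)"
        using assms(2-4) by (intro exp_bump_minus_one_le) auto
      then show ?thesis
        using assms by (simp add: m_def ennreal_leI mult.assoc flip: ennreal_mult)
    qed
    then have "(\<integral>\<^sup>+x. m x \<partial>lborel) \<le> (\<integral>\<^sup>+x. ennreal (2 * h) * ennreal (bump r x) \<partial>lborel)"
      by (intro nn_integral_mono)
    also have "\<dots> \<le> ennreal (2 * h) * ennreal r"
      using assms by (simp add: nn_integral_cmult mult_left_mono nn_integral_bump_le)
    finally show ?thesis
      using assms by (simp flip: ennreal_mult)
  qed
  obtain Q where [measurable]: "Q \<in> borel_measurable borel"
    and Q: "\<And>x. (fk_step h m ^^ n) (\<lambda>_. 1) x = 1 + Q x"
    and int_Q: "(\<integral>\<^sup>+x. Q x \<partial>lborel) \<le> of_nat n * (2 * (\<integral>\<^sup>+x. m x \<partial>lborel))"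
    using fk_step_excess_integral [of m h 2 n] fk_step_bump_le_two [OF assms(2-4)] assms(3)
    by (auto simp: m_def [abs_def])
  \<comment> \<open>For fixed \<open>x\<close> the Feynman--Kac formula computes the expectation of
    the full exponential as \<open>1 + Q x\<close>; the finite summand 1 cancels.\<close>
  have E: "(\<integral>\<^sup>+\<omega>. ?f \<omega> x \<partial>M) = Q x" for x
  proof -
    have "1 + ?f \<omega> x = (\<Prod>j<n. 1 + m (x + W (real j * h) \<omega>))" for \<omega>
    proof -
      have "0 \<le> (\<Sum>j<n. h * bump r (x + W (real j * h) \<omega>))"
        using assms by (intro sum_nonneg) auto
      then have "1 + ?f \<omega> x = ennreal (exp (\<Sum>j<n. h * bump r (x + W (real j * h) \<omega>)))"
        by (simp add: ennreal_plus [symmetric] del: ennreal_plus flip: ennreal_1)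
      then show ?thesis
        using assms by (subst (asm) ennreal_exp_sum_eq_prod) (auto simp: m_def)
    qed
    then have "1 + Q x = (\<integral>\<^sup>+\<omega>. 1 + ?f \<omega> x \<partial>M)"
      by (simp add: Q [symmetric] brownian_motion3_feynman_kac [OF assms(1,3)])
    also have "\<dots> = 1 + (\<integral>\<^sup>+\<omega>. ?f \<omega> x \<partial>M)"
      by (subst nn_integral_add) (auto simp: emeasure_space_1)
    finally show ?thesis
      by (simp add: ennreal_add_left_cancel)
  qed
  have "(\<integral>\<^sup>+\<omega>. \<integral>\<^sup>+x. ?f \<omega> x \<partial>lborel \<partial>M) = (\<integral>\<^sup>+x. \<integral>\<^sup>+\<omega>. ?f \<omega> x \<partial>M \<partial>lborel)"
    by (rule pair_sigma_finite.Fubini' [symmetric])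
      (auto simp: pair_sigma_finite_def sigma_finite_lborel prob_space_imp_sigma_finite prob_space_axioms)
  also have "\<dots> \<le> of_nat n * (2 * ennreal (2 * h * r))"
    unfolding E by (rule order_trans [OF int_Q]) (intro mult_left_mono int_m; simp)
  also have "\<dots> = ennreal (4 * (real n * h) * r)"
    using assms by (simp add: ennreal_of_nat_eq_real_of_nat ac_simps flip: ennreal_mult ennreal_numeral)
  finally show "(\<integral>\<^sup>+\<omega>. \<integral>\<^sup>+x. ?f \<omega> x \<partial>lborel \<partial>M) \<le> ennreal (4 * (real n * h) * r)" .
qed

subsection \<open>Pathwise estimates\<close>

text \<open>These left-endpoint sums are the functionals that the walk at equidistant times
  produces. By uniform continuity each interval of length \<open>h\<close> contributes an error of
  at most \<open>h * e'\<close>, in total \<open>t * e'\<close>, half of \<open>e\<close>.\<close>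

lemma riemann_sum_tendsto_integral:
  fixes g :: "real \<Rightarrow> real"
  assumes "t > 0" and cont: "continuous_on {0..t} g"
  shows "(\<lambda>n. \<Sum>j<n. t / real n * g (real j * (t / real n))) \<longlonglongrightarrow> integral {0..t} g"
proof (rule LIMSEQ_I)
  fix e :: real
  assume "e > 0"
  define e' where "e' = e / (2 * t)"
  have "e' > 0"
    using \<open>e > 0\<close> \<open>t > 0\<close> by (simp add: e'_def)
  have "uniformly_continuous_on {0..t} g"
    using cont by (intro compact_uniformly_continuous) auto
  then obtain d where "d > 0"
    and d: "\<And>x y. x \<in> {0..t} \<Longrightarrow> y \<in> {0..t} \<Longrightarrow> dist y x < d \<Longrightarrow> dist (g y) (g x) < e'"
    using \<open>e' > 0\<close> unfolding uniformly_continuous_on_def by metis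
  obtain N :: nat where N: "t / d < real N"
    using reals_Archimedean2 by blast
  have "norm ((\<Sum>j<n. t / real n * g (real j * (t / real n))) - integral {0..t} g) < e" if "n \<ge> Suc N" for n
  proof -
    define h where "h = t / real n"
    have "n > 0" "real n > t / d"
      using that N by auto
    then have h: "0 < h" "h < d" "real n * h = t"
      using \<open>t > 0\<close> \<open>d > 0\<close> by (auto simp: h_def field_simps)
    have "\<bar>(\<Sum>j<k. h * g (real j * h)) - integral {0..real k * h} g\<bar> \<le> real k * (h * e')" if "k \<le> n" for k
      using that
    proof (induction k)
      case 0
      then show ?case by simp
    next
      case (Suc k)
      have kh: "0 \<le> real k * h" "real k * h \<le> real (Suc k) * h" "real (Suc k) * h \<le> t"
        using h Suc.prems mult_right_mono [of "real (Suc k)" "real n" h] by (auto simp: algebra_simps)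
      have int: "g integrable_on {a..b}" if "0 \<le> a" "b \<le> t" for a b
        using that by (intro integrable_continuous_interval continuous_on_subset [OF cont]) auto
      have "integral {0..real k * h} g + integral {real k * h..real (Suc k) * h} g
          = integral {0..real (Suc k) * h} g"
        using kh by (intro Henstock_Kurzweil_Integration.integral_combine int) auto
      moreover have "\<bar>integral {real k * h..real (Suc k) * h} g - h * g (real k * h)\<bar> \<le> h * e'"
      proof -
        have "integral {real k * h..real (Suc k) * h} (\<lambda>s. g s - g (real k * h))
            = integral {real k * h..real (Suc k) * h} g - h * g (real k * h)"
          using kh by (subst Henstock_Kurzweil_Integration.integral_diff) (auto intro!: int simp: algebra_simps)
        moreover have "norm (integral {real k * h..real (Suc k) * h} (\<lambda>s. g s - g (real k * h)))
            \<le> e' * (real (Suc k) * h - real k * h)"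
        proof (rule integral_bound)
          show "continuous_on {real k * h..real (Suc k) * h} (\<lambda>s. g s - g (real k * h))"
            using kh by (intro continuous_intros continuous_on_subset [OF cont]) auto
          show "norm (g s - g (real k * h)) \<le> e'" if "s \<in> {real k * h..real (Suc k) * h}" for s
          proof -
            have "dist s (real k * h) < d"
              using that h by (simp add: dist_real_def algebra_simps)
            moreover have "s \<in> {0..t}" "real k * h \<in> {0..t}"
              using that kh by auto
            ultimately show ?thesis
              using d [of "real k * h" s] by (simp add: dist_norm)
          qed
        qed (use kh in simp)
        ultimately show ?thesis
          by (simp add: algebra_simps)
      qed
      ultimately show ?case
        using Suc by (simp add: algebra_simps)
    qed
    from this [of n] have "\<bar>(\<Sum>j<n. h * g (real j * h)) - integral {0..t} g\<bar> \<le> t * e'"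
      using h by (simp add: mult.assoc [symmetric])
    also have "\<dots> < e"
      using \<open>t > 0\<close> \<open>e > 0\<close> by (simp add: e'_def)
    finally show ?thesis
      by (simp add: h_def)
  qed
  then show "\<exists>N. \<forall>n\<ge>N. norm ((\<Sum>j<n. t / real n * g (real j * (t / real n))) - integral {0..t} g) < e"
    by blast
qed

text \<open>The path is controlled only on \<open>{0..t}\<close>, so it is extended by 0 to a Borel
  function on the whole line.\<close>

lemma ball_occupation_measurable:
  fixes w :: "real \<Rightarrow> real^3"
  assumes "continuous_on {0..t} w"
  shows "{s \<in> {0..t}. norm (w s - x) < r} \<in> sets borel"
proof -
  have [measurable]: "(\<lambda>s. indicator {0..t} s *\<^sub>R w s) \<in> borel_measurable borel"
    using assms by (intro borel_measurable_continuous_on_indicator) auto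
  have "{s \<in> {0..t}. norm (w s - x) < r}
      = {s \<in> space borel. s \<in> {0..t} \<and> norm (indicator {0..t} s *\<^sub>R w s - x) < r}"
    by auto
  also have "\<dots> \<in> sets borel"
    by measurable
  finally show ?thesis .
qed

text \<open>If the path spends time \<open>a\<close> in the ball of radius \<open>r\<close> about \<open>z\<close>, then
  \<open>\<integral> bump r (x + w s) ds \<ge> a / (216 r\<^sup>2)\<close> for every \<open>x\<close> within distance \<open>r\<close> of \<open>- z\<close>.\<close>

lemma occupation_le_of_riemann_exp:
  fixes w :: "real \<Rightarrow> real^3"
  assumes "t > 0" "r > 0" "a > 0" and cont: "continuous_on {0..t} w"
    and small: "liminf (\<lambda>n. \<integral>\<^sup>+x. ennreal (exp (\<Sum>j<n. t / real n * bump r (x + w (real j * (t / real n)))) - 1) \<partial>lborel)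
      < ennreal (r ^ 3 * (exp (a / (216 * r\<^sup>2)) - 1))"
  shows "emeasure lborel {s \<in> {0..t}. norm (w s - z) < r} \<le> ennreal a"
proof (rule ccontr)
  let ?O = "{s \<in> {0..t}. norm (w s - z) < r}"
  let ?S = "\<lambda>n x. \<Sum>j<n. t / real n * bump r (x + w (real j * (t / real n)))"
  let ?e = "exp (a / (216 * r\<^sup>2)) - 1"
  have O [measurable]: "?O \<in> sets borel"
    by (rule ball_occupation_measurable [OF cont])
  have "emeasure lborel ?O \<le> emeasure lborel {0..t}"
    by (intro emeasure_mono) auto
  then have fin: "emeasure lborel ?O < \<infinity>"
    using assms by (simp add: le_less_trans)
  assume "\<not> emeasure lborel ?O \<le> ennreal a"
  then have a: "a \<le> measure lborel ?O"
    using fin \<open>a > 0\<close> by (simp add: emeasure_eq_ennreal_measure ennreal_less_iff not_le less_imp_le)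
  \<comment> \<open>The Riemann sums converge to the integral of the bump along the path, which is
    at least the occupation time times the minimum of the bump on \<open>?O\<close>. The ball is
    centred at \<open>- z\<close> because the bump is evaluated at \<open>x + w s\<close>.\<close>
  have "ennreal ?e \<le> liminf (\<lambda>n. ennreal (exp (?S n x) - 1))" if "x \<in> ball (- z) r" for x
  proof -
    have cont_bump: "continuous_on {0..t} (\<lambda>s. bump r (x + w s))"
      by (intro continuous_intros cont)
    have int_bump: "set_integrable lborel {0..t} (\<lambda>s. bump r (x + w s))"
      unfolding set_integrable_def by (intro borel_integrable_compact cont_bump) auto
    \<comment> \<open>Within distance \<open>2 * r\<close> the exponent is at least -2, and
      \<open>exp 2 \<le> 9\<close> gives the constant 216 = 9 * 24.\<close>
    have bump_ge: "1 / (216 * r\<^sup>2) \<le> bump r (x + w s)" if "s \<in> ?O" for s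
    proof -
      have "norm (x + w s) \<le> norm (x + z) + norm (w s - z)"
        using norm_triangle_ineq [of "x + z" "w s - z"] by simp
      also have "\<dots> \<le> 2 * r"
        using that \<open>x \<in> ball (- z) r\<close> by (simp add: dist_norm norm_minus_commute add.commute)
      finally have "(norm (x + w s))\<^sup>2 \<le> (2 * r)\<^sup>2"
        by (intro power_mono) auto
      then have "(norm (x + w s))\<^sup>2 / (2 * r\<^sup>2) \<le> 2"
        using \<open>r > 0\<close> by (simp add: divide_simps power_mult_distrib)
      then have exp_ge: "exp (-2) \<le> exp (- (norm (x + w s))\<^sup>2 / (2 * r\<^sup>2))"
        by simp
      have "exp (2::real) \<le> 9"
        using exp_le power_mono [of "exp 1" "3::real" 2] by (simp add: exp_of_nat_mult [symmetric] flip: exp_double)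
      then have "1 / 9 \<le> exp (-2 :: real)"
        by (simp add: exp_minus divide_simps)
      then have "1 / 9 / (24 * r\<^sup>2) \<le> bump r (x + w s)"
        unfolding bump_def by (intro divide_right_mono order_trans [OF _ exp_ge]) auto
      then show ?thesis by simp
    qed
    have "a / (216 * r\<^sup>2) \<le> measure lborel ?O * (1 / (216 * r\<^sup>2))"
      using a \<open>r > 0\<close> by (simp add: divide_right_mono)
    also have "\<dots> = (\<integral>s. indicator ?O s * (1 / (216 * r\<^sup>2)) \<partial>lborel)"
      using fin O by simp
    also have "\<dots> \<le> (LINT s:{0..t}|lborel. bump r (x + w s))"
      unfolding set_lebesgue_integral_def
    proof (rule integral_mono)
      show "integrable lborel (\<lambda>s. indicator ?O s * (1 / (216 * r\<^sup>2)))"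
        using fin O by (intro integrable_mult_left integrable_real_indicator) auto
      show "integrable lborel (\<lambda>s. indicator {0..t} s *\<^sub>R bump r (x + w s))"
        using int_bump by (simp add: set_integrable_def)
      show "indicator ?O s * (1 / (216 * r\<^sup>2)) \<le> indicator {0..t} s *\<^sub>R bump r (x + w s)" for s
        using bump_ge [of s] by (auto simp: indicator_def)
    qed
    also have "\<dots> = integral {0..t} (\<lambda>s. bump r (x + w s))"
      by (rule set_borel_integral_eq_integral [OF int_bump])
    finally have le: "?e \<le> exp (integral {0..t} (\<lambda>s. bump r (x + w s))) - 1"
      by simp
    have "(\<lambda>n. ennreal (exp (?S n x) - 1)) \<longlonglongrightarrow> ennreal (exp (integral {0..t} (\<lambda>s. bump r (x + w s))) - 1)"
      by (intro tendsto_intros riemann_sum_tendsto_integral [OF \<open>t > 0\<close> cont_bump])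
    then show ?thesis
      using le by (simp add: lim_imp_Liminf ennreal_leI)
  qed
  then have "ennreal ?e * indicator (ball (- z) r) x \<le> liminf (\<lambda>n. ennreal (exp (?S n x) - 1))" for x
    by (auto simp: indicator_def)
  then have "(\<integral>\<^sup>+x. ennreal ?e * indicator (ball (- z) r) x \<partial>lborel)
      \<le> (\<integral>\<^sup>+x. liminf (\<lambda>n. ennreal (exp (?S n x) - 1)) \<partial>lborel)"
    by (intro nn_integral_mono)
  also have "\<dots> \<le> liminf (\<lambda>n. \<integral>\<^sup>+x. ennreal (exp (?S n x) - 1) \<partial>lborel)"
    by (intro nn_integral_liminf) measurable
  finally have "ennreal ?e * emeasure lborel (ball (- z) r) < ennreal (r ^ 3 * ?e)"
    using small by (simp add: nn_integral_cmult_indicator le_less_trans)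
  \<comment> \<open>The volume of the ball is at least \<open>r ^ 3\<close>, which contradicts the
    upper bound just obtained from Fatou's lemma in \<open>x\<close>.\<close>
  moreover have "ennreal (r ^ 3 * ?e) \<le> ennreal ?e * emeasure lborel (ball (- z) r)"
  proof -
    have "1 * r ^ 3 \<le> unit_ball_vol 3 * r ^ 3"
      using pi_gt3 \<open>r > 0\<close> by (intro mult_right_mono) (auto simp: unit_ball_vol_3)
    then have "?e * (r ^ 3) \<le> ?e * (unit_ball_vol 3 * r ^ 3)"
      using \<open>a > 0\<close> by (intro mult_left_mono) auto
    then show ?thesis
      using \<open>r > 0\<close> \<open>a > 0\<close> by (simp add: emeasure_ball mult.commute [of "r ^ 3"] ennreal_leI flip: ennreal_mult)
  qed
  ultimately show False
    by simp
qed

section \<open>Splitting the Coulomb kernel into scales\<close>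

lemma inverse_norm_cutoff_le:
  fixes y :: "'a::real_normed_vector"
  assumes "\<rho> > 0"
  shows "ennreal \<bar>1 / norm y - 1 / max (norm y) (\<rho>\<^sup>2)\<bar>
    \<le> (\<Sum>k. ennreal (4 / ((\<rho> / 2 ^ k)\<^sup>2)) * indicator {y. norm y < (\<rho> / 2 ^ k)\<^sup>2} y)"
    (is "_ \<le> (\<Sum>k. ?f k)")
proof -
  have f_le: "?f k \<le> (\<Sum>k. ?f k)" for k
  proof (rule ccontr)
    assume "\<not> ?f k \<le> (\<Sum>k. ?f k)"
    then have "(\<Sum>k. ?f k) < ?f k"
      by (simp only: not_le)
    then have "?f k < ?f k"
      by (rule ennreal_suminf_lessD)
    then show False
      by (rule less_irrefl [THEN notE])
  qed
  consider "y = 0" | "y \<noteq> 0" "norm y < \<rho>\<^sup>2" | "norm y \<ge> \<rho>\<^sup>2"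
    by linarith
  then show ?thesis
  proof cases
    case 1
    \<comment> \<open>Since \<open>1 / 0 = 0\<close>, the left-hand side is just the cutoff value at
      the origin, which the scale \<open>k = 0\<close> covers.\<close>
    have "1 / \<rho>\<^sup>2 \<le> 4 / \<rho>\<^sup>2"
      by (intro divide_right_mono) auto
    then have "ennreal \<bar>1 / norm y - 1 / max (norm y) (\<rho>\<^sup>2)\<bar> \<le> ?f 0"
      using 1 assms by (simp add: max_def ennreal_leI)
    with f_le [of 0] show ?thesis by simp
  next
    case 3
    then show ?thesis by (simp add: max_def)
  next
    case 2
    \<comment> \<open>The last scale \<open>k\<close> whose ball still contains \<open>y\<close>
      suffices: \<open>y\<close> lies outside the next ball, whose radius is a quarter as large, so
      the single summand \<open>k\<close> dominates \<open>1 / norm y\<close>.\<close>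
    define P where "P k \<longleftrightarrow> norm y < (\<rho> / 2 ^ k)\<^sup>2" for k :: nat
    have eq: "(\<rho> / 2 ^ k)\<^sup>2 = \<rho>\<^sup>2 * (1 / 4) ^ k" for k
      by (simp add: power_divide power_mult [symmetric] mult.commute [of k] power_mult)
    have "\<exists>k. \<not> P k"
    proof -
      have "(\<lambda>k. \<rho>\<^sup>2 * (1 / 4) ^ k) \<longlonglongrightarrow> \<rho>\<^sup>2 * 0"
        by (intro tendsto_intros LIMSEQ_realpow_zero) auto
      then have "eventually (\<lambda>k. \<rho>\<^sup>2 * (1 / 4) ^ k < norm y) sequentially"
        using 2 by (intro order_tendstoD) auto
      then show ?thesis
        unfolding P_def eq eventually_sequentially by (metis less_imp_not_less order_refl)
    qed
    moreover have "P 0"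
      using 2 by (simp add: P_def)
    ultimately obtain k where k: "P k" "\<not> P (Suc k)"
      by (metis nat_induct)
    have "(\<rho> / 2 ^ k)\<^sup>2 \<le> 4 * norm y"
      using k(2) unfolding P_def eq by (simp add: not_less)
    then have "1 / norm y \<le> 4 / (\<rho> / 2 ^ k)\<^sup>2"
      using 2 assms by (simp add: divide_simps mult.commute)
    moreover have "\<bar>1 / norm y - 1 / max (norm y) (\<rho>\<^sup>2)\<bar> \<le> 1 / norm y"
    proof -
      have "1 / \<rho>\<^sup>2 \<le> 1 / norm y"
        using 2 assms by (intro divide_left_mono) auto
      then show ?thesis
        using 2 by (simp add: max_def)
    qed
    ultimately have "ennreal \<bar>1 / norm y - 1 / max (norm y) (\<rho>\<^sup>2)\<bar> \<le> ?f k"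
      using k(1) by (simp add: P_def ennreal_leI)
    with f_le [of k] show ?thesis by (rule order_trans [rotated])
  qed
qed

lemma inverse_max_lipschitz:
  fixes u v c :: real
  assumes "c > 0"
  shows "\<bar>1 / max u c - 1 / max v c\<bar> \<le> \<bar>u - v\<bar> / c\<^sup>2"
proof -
  have pos: "c \<le> max u c" "c \<le> max v c" by auto
  have p2: "max u c > 0" "max v c > 0"
    using assms by auto
  have "\<bar>1 / max u c - 1 / max v c\<bar> = \<bar>max u c - max v c\<bar> / (max u c * max v c)"
  proof -
    have "1 / max u c - 1 / max v c = (max v c - max u c) / (max u c * max v c)"
      using p2 by (intro diff_frac_eq [THEN trans]) auto
    then show ?thesis
      using p2 by (simp add: abs_minus_commute abs_mult)
  qed
  also have "\<dots> \<le> \<bar>u - v\<bar> / c\<^sup>2"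
  proof (rule frac_le)
    show "c\<^sup>2 \<le> max u c * max v c"
      unfolding power2_eq_square using pos assms by (intro mult_mono) auto
  qed (use assms in auto)
  finally show ?thesis .
qed

text \<open>Each of the two points loses at most \<open>8 * \<rho>\<close> when its kernel is
  replaced by the cutoff \<open>K\<close>; the cutoff potentials differ by at most the Lipschitz
  constant of \<open>K\<close> times \<open>\<delta>\<close>.\<close>

lemma Lambda_diff_le:
  assumes "t > 0" "\<rho> > 0" and cont: "continuous_on {0..t} (\<lambda>s. W s \<omega>)"
    and occ: "\<And>k z. emeasure lborel {s \<in> {0..t}. norm (W s \<omega> - z) < (\<rho> / 2 ^ k)\<^sup>2} \<le> ennreal ((\<rho> / 2 ^ k) ^ 3 * t)"
    and "dist x1 x2 \<le> \<delta>"
  shows "\<bar>Lambda W t \<omega> x1 - Lambda W t \<omega> x2\<bar> \<le> 16 * \<rho> + \<delta> / \<rho> ^ 4"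
proof -
  define K where "K y = 1 / max (norm y) (\<rho>\<^sup>2)" for y :: "real^3"
  define w where "w s = indicator {0..t} s *\<^sub>R W s \<omega>" for s
  have [measurable]: "w \<in> borel_measurable borel"
    unfolding w_def [abs_def] using cont by (intro borel_measurable_continuous_on_indicator) auto
  have [measurable]: "K \<in> borel_measurable borel"
    unfolding K_def by measurable
  have K_bound: "0 \<le> K y" "K y \<le> 1 / \<rho>\<^sup>2" for y
    unfolding K_def using \<open>\<rho> > 0\<close> by (auto intro!: divide_left_mono mult_pos_pos simp: less_max_iff_disj le_max_iff_disj)
  define I where "I x = (\<integral>s. indicator {0..t} s * K (w s - x) \<partial>lborel)" for x
  have int_t: "integrable lborel (\<lambda>s. indicator {0..t} s :: real)"
    by (intro integrable_real_indicator) (use \<open>t > 0\<close> in auto)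
  have int_K: "integrable lborel (\<lambda>s. indicator {0..t} s * K (w s - x))" for x
  proof (rule Bochner_Integration.integrable_bound)
    show "integrable lborel (\<lambda>s. indicator {0..t} s * (1 / \<rho>\<^sup>2) :: real)"
      using int_t by (rule integrable_mult_left)
    show "AE s in lborel. norm (indicator {0..t} s * K (w s - x)) \<le> norm (indicator {0..t} s * (1 / \<rho>\<^sup>2))"
      using K_bound by (auto simp: indicator_def)
  qed measurable
  have Lambda: "\<bar>Lambda W t \<omega> x - I x / t\<bar> \<le> 8 * \<rho>" for x
  proof -
    let ?D = "\<lambda>s. indicator {0..t} s * (1 / norm (w s - x) - K (w s - x))"
    have sing: "(\<integral>\<^sup>+s. ennreal (norm (?D s)) \<partial>lborel) \<le> ennreal (8 * \<rho> * t)"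
    proof -
      define A where "A k = {s \<in> {0..t}. norm (W s \<omega> - x) < (\<rho> / 2 ^ k)\<^sup>2}" for k :: nat
      have [measurable]: "A k \<in> sets borel" for k
        unfolding A_def by (rule ball_occupation_measurable [OF cont])
      have occ_A: "emeasure lborel (A k) \<le> ennreal ((\<rho> / 2 ^ k) ^ 3 * t)" for k
        unfolding A_def by (rule occ)
      have "ennreal (norm (?D s)) \<le> (\<Sum>k. ennreal (4 / (\<rho> / 2 ^ k)\<^sup>2) * indicator (A k) s)" for s
      proof (cases "s \<in> {0..t}")
        case True
        then have "norm (?D s) = \<bar>1 / norm (W s \<omega> - x) - 1 / max (norm (W s \<omega> - x)) (\<rho>\<^sup>2)\<bar>"
          by (simp add: K_def w_def)
        moreover have "indicator (A k) s = (indicator {y. norm y < (\<rho> / 2 ^ k)\<^sup>2} (W s \<omega> - x) :: ennreal)" for k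
          using True by (simp add: A_def indicator_def)
        ultimately show ?thesis
          using inverse_norm_cutoff_le [OF \<open>\<rho> > 0\<close>, of "W s \<omega> - x"] by (simp only:)
      qed (simp add: A_def)
      then have "(\<integral>\<^sup>+s. ennreal (norm (?D s)) \<partial>lborel)
          \<le> (\<integral>\<^sup>+s. (\<Sum>k. ennreal (4 / (\<rho> / 2 ^ k)\<^sup>2) * indicator (A k) s) \<partial>lborel)"
        by (intro nn_integral_mono)
      also have "\<dots> = (\<Sum>k. ennreal (4 / (\<rho> / 2 ^ k)\<^sup>2) * emeasure lborel (A k))"
        by (simp add: nn_integral_suminf nn_integral_cmult_indicator)
      also have "\<dots> \<le> (\<Sum>k. ennreal (4 / (\<rho> / 2 ^ k)\<^sup>2) * ennreal ((\<rho> / 2 ^ k) ^ 3 * t))"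
        by (intro suminf_le mult_left_mono occ_A summableI) simp_all
      \<comment> \<open>A scale of radius \<open>(\<rho> / 2 ^ k)\<^sup>2\<close> contributes its
        3/2-th power divided by the radius, that is, its square root \<open>\<rho> / 2 ^ k\<close>:
        a geometric series.\<close>
      also have "\<dots> = (\<Sum>k. ennreal (4 * \<rho> * t * (1 / 2) ^ k))"
      proof (rule arg_cong [of _ _ suminf], rule ext)
        fix k
        have "4 / (\<rho> / 2 ^ k)\<^sup>2 * ((\<rho> / 2 ^ k) ^ 3 * t) = 4 * \<rho> * t * (1 / 2) ^ k"
          using \<open>\<rho> > 0\<close> by (simp add: power2_eq_square power3_eq_cube power_one_over field_simps)
        then show "ennreal (4 / (\<rho> / 2 ^ k)\<^sup>2) * ennreal ((\<rho> / 2 ^ k) ^ 3 * t) = ennreal (4 * \<rho> * t * (1 / 2) ^ k)"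
          using \<open>\<rho> > 0\<close> \<open>t > 0\<close> by (simp flip: ennreal_mult)
      qed
      also have "\<dots> = ennreal (8 * \<rho> * t)"
      proof (rule suminf_ennreal_eq)
        show "(\<lambda>k. 4 * \<rho> * t * (1 / 2) ^ k) sums (8 * \<rho> * t)"
          using sums_mult [OF geometric_sums [of "1 / 2 :: real"], of "4 * \<rho> * t"] by (simp add: mult.assoc)
      qed (use assms in auto)
      finally show ?thesis .
    qed
    \<comment> \<open>The occupation bounds also make the singular kernel integrable along the path,
      so the Bochner integral in \<open>Lambda\<close> is a genuine one and splits into
      \<open>?D\<close> and the cutoff part.\<close>
    have int_D: "integrable lborel ?D"
    proof (rule integrableI_bounded)
      show "(\<integral>\<^sup>+s. ennreal (norm (?D s)) \<partial>lborel) < \<infinity>"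
        using sing by (rule le_less_trans) simp
    qed measurable
    have "(\<integral>s. ?D s + indicator {0..t} s * K (w s - x) \<partial>lborel) = (\<integral>s. ?D s \<partial>lborel) + I x"
      unfolding I_def by (intro Bochner_Integration.integral_add int_D int_K)
    moreover have "(\<lambda>s. ?D s + indicator {0..t} s * K (w s - x)) = (\<lambda>s. indicator {0..t} s *\<^sub>R (1 / norm (W s \<omega> - x)))"
      by (auto simp: fun_eq_iff indicator_def w_def)
    ultimately have "t * Lambda W t \<omega> x - I x = (\<integral>s. ?D s \<partial>lborel)"
      using \<open>t > 0\<close> by (simp add: Lambda_def set_lebesgue_integral_def)
    moreover have "\<bar>\<integral>s. ?D s \<partial>lborel\<bar> \<le> 8 * \<rho> * t"
      using order_trans [OF integral_norm_bound_ennreal [OF int_D] sing] assms by simp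
    ultimately show ?thesis
      using \<open>t > 0\<close> by (simp add: field_simps abs_le_iff)
  qed
  have "\<bar>I x1 - I x2\<bar> \<le> t * (\<delta> / \<rho> ^ 4)"
  proof -
    have Klip: "\<bar>K (w s - x1) - K (w s - x2)\<bar> \<le> \<delta> / \<rho> ^ 4" for s
    proof -
      have "\<bar>norm (w s - x1) - norm (w s - x2)\<bar> \<le> norm ((w s - x1) - (w s - x2))"
        by (rule norm_triangle_ineq3)
      also have "\<dots> \<le> \<delta>"
        using \<open>dist x1 x2 \<le> \<delta>\<close> by (simp add: dist_norm norm_minus_commute)
      finally have "\<bar>norm (w s - x1) - norm (w s - x2)\<bar> / (\<rho>\<^sup>2)\<^sup>2 \<le> \<delta> / (\<rho>\<^sup>2)\<^sup>2"
        by (intro divide_right_mono) auto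
      with inverse_max_lipschitz [of "\<rho>\<^sup>2" "norm (w s - x1)" "norm (w s - x2)"] show ?thesis
        using \<open>\<rho> > 0\<close> by (simp add: K_def flip: power_mult)
    qed
    have "I x1 - I x2 = (\<integral>s. indicator {0..t} s * (K (w s - x1) - K (w s - x2)) \<partial>lborel)"
      unfolding I_def by (simp add: right_diff_distrib Bochner_Integration.integral_diff int_K)
    also have "\<bar>\<dots>\<bar> \<le> (\<integral>s. indicator {0..t} s * (\<delta> / \<rho> ^ 4) \<partial>lborel)"
    proof (rule order_trans [OF integral_abs_bound], rule integral_mono)
      show "integrable lborel (\<lambda>s. \<bar>indicator {0..t} s * (K (w s - x1) - K (w s - x2))\<bar>)"
        by (intro integrable_abs) (simp add: right_diff_distrib Bochner_Integration.integrable_diff int_K)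
      show "integrable lborel (\<lambda>s. indicator {0..t} s * (\<delta> / \<rho> ^ 4))"
        using int_t by (rule integrable_mult_left)
      show "\<bar>indicator {0..t} s * (K (w s - x1) - K (w s - x2))\<bar> \<le> indicator {0..t} s * (\<delta> / \<rho> ^ 4)" for s
        using Klip [of s] by (auto simp: indicator_def)
    qed
    also have "\<dots> = t * (\<delta> / \<rho> ^ 4)"
      using \<open>t > 0\<close> by simp
    finally show ?thesis .
  qed
  then have "\<bar>I x1 / t - I x2 / t\<bar> \<le> \<delta> / \<rho> ^ 4"
    using \<open>t > 0\<close> by (simp add: diff_divide_distrib [symmetric] divide_le_eq mult.commute)
  with Lambda [of x1] Lambda [of x2] show ?thesis
    by linarith
qed

subsection \<open>The exponential tail bound\<close>

text \<open>Absorbs a fourth power into half of the exponential rate. The estimate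
  \<open>exp (y / 2) \<ge> (1 + y / 8) ^ 4\<close> yields 4096 = 8^4, and \<open>exp y - 1\<close>
  is at least \<open>exp (y / 2) * (exp (y / 2) - 1)\<close>.\<close>

lemma power4_div_exp_minus_one_le:
  fixes y :: real
  assumes "y > 0"
  shows "y ^ 4 / (exp y - 1) \<le> 4096 * exp (- y / 2)"
proof -
  have "(1 + u) ^ 4 = 1 + u ^ 4 + u * (4 + 6 * u + 4 * u\<^sup>2)" for u :: real
    by (simp add: power4_eq_xxxx power2_eq_square algebra_simps)
  from this [of "y / 8"] have "1 + (y / 8) ^ 4 \<le> (1 + (y / 2) / real 4) ^ 4"
    using assms by simp
  also have "\<dots> \<le> exp (y / 2)"
    using assms by (intro exp_ge_one_plus_x_over_n_power_n) auto
  finally have "y ^ 4 / 4096 \<le> exp (y / 2) - 1"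
    by (simp add: power_divide)
  also have "\<dots> \<le> exp (y / 2) * (exp (y / 2) - 1) / exp (y / 2)"
    by simp
  also have "\<dots> \<le> (exp y - 1) * exp (- y / 2)"
  proof -
    have "exp (y / 2) * exp (y / 2) = exp y"
      by (simp flip: exp_add)
    moreover have "1 \<le> exp (y / 2)"
      using assms by simp
    ultimately show ?thesis
      by (simp add: right_diff_distrib exp_minus divide_simps)
  qed
  finally show ?thesis
    using assms by (simp add: divide_simps mult_ac)
qed

text \<open>All scales are handled by one random variable \<open>Y\<close>, the sum of the
  functionals \<open>L k\<close> divided by their thresholds. Markov's inequality for
  \<open>Y\<close> gives a measurable exceptional set that serves every \<open>k\<close> and every
  centre \<open>z\<close> at once.\<close>

lemma brownian_motion3_occupation_tail:
  assumes "brownian_motion3 M W" "0 < \<rho>" "\<rho> \<le> 1 / 432" "1 \<le> t"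
  obtains A where "A \<in> sets M" "measure M A \<le> 8 * 216 ^ 4 * 4096 * t * exp (- (t / (432 * \<rho>)))"
    "\<And>\<omega> k z. \<omega> \<in> space M - A \<Longrightarrow>
       emeasure lborel {s \<in> {0..t}. norm (W s \<omega> - z) < (\<rho> / 2 ^ k)\<^sup>2} \<le> ennreal ((\<rho> / 2 ^ k) ^ 3 * t)"
proof -
  interpret prob_space M
    by (rule brownian_motion3D [OF assms(1)])
  define R where "R k = (\<rho> / 2 ^ k)\<^sup>2" for k :: nat
  \<comment> \<open>\<open>y k\<close> is the exponent in
    \<open>occupation_le_of_riemann_exp\<close> for radius \<open>R k\<close> and time
    \<open>(\<rho> / 2 ^ k) ^ 3 * t\<close>, and \<open>c k\<close> is the corresponding
    threshold.\<close>
  define y where "y k = t / (216 * (\<rho> / 2 ^ k))" for k :: nat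
  define c where "c k = R k ^ 3 * (exp (y k) - 1)" for k
  define X where "X k n \<omega> = (\<integral>\<^sup>+x. ennreal (exp (\<Sum>j<n. t / real n * bump (R k) (x + W (real j * (t / real n)) \<omega>)) - 1) \<partial>lborel)"
    for k n \<omega>
  define L where "L k \<omega> = liminf (\<lambda>n. X k n \<omega>)" for k \<omega>
  define Y where "Y \<omega> = (\<Sum>k. ennreal (1 / c k) * L k \<omega>)" for \<omega>
  define q where "q = exp (- (t / (432 * \<rho>)))"
  define C :: real where "C = 4 * 216 ^ 4 * 4096"
  have R_pos: "R k > 0" and y_pos: "y k > 0" for k
    using assms by (auto simp: R_def y_def)
  then have c_pos: "c k > 0" for k
    by (simp add: c_def)
  have X_meas [measurable]: "X k n \<in> borel_measurable M" for k n
  proof -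
    have [measurable]: "(\<lambda>(\<omega>, x). ennreal (exp (\<Sum>j<n. t / real n * bump (R k) (x + W (real j * (t / real n)) \<omega>)) - 1))
        \<in> borel_measurable (M \<Otimes>\<^sub>M lborel)"
      using assms by (intro brownian_motion3_riemann_exp_measurable) auto
    show ?thesis
      unfolding X_def [abs_def] by measurable
  qed
  have [measurable]: "L k \<in> borel_measurable M" for k
    unfolding L_def [abs_def] by measurable
  have [measurable]: "Y \<in> borel_measurable M"
    unfolding Y_def [abs_def] by measurable
  \<comment> \<open>Fatou's lemma in the number \<open>n\<close> of time steps: the moment bound
    applies as soon as the mesh \<open>t / real n\<close> is below
    \<open>(R k)\<^sup>2\<close>.\<close>
  have int_L: "(\<integral>\<^sup>+\<omega>. L k \<omega> \<partial>M) \<le> ennreal (4 * t * R k)" for k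
  proof -
    have "(\<integral>\<^sup>+\<omega>. L k \<omega> \<partial>M) \<le> liminf (\<lambda>n. \<integral>\<^sup>+\<omega>. X k n \<omega> \<partial>M)"
      unfolding L_def by (intro nn_integral_liminf) measurable
    also have "\<dots> \<le> liminf (\<lambda>n. ennreal (4 * t * R k))"
    proof (rule Liminf_mono)
      have "(\<lambda>n. t / real n) \<longlonglongrightarrow> 0"
        by (rule lim_const_over_n)
      then have "eventually (\<lambda>n. t / real n < (R k)\<^sup>2) sequentially"
        using R_pos [of k] by (intro order_tendstoD) auto
      then show "eventually (\<lambda>n. (\<integral>\<^sup>+\<omega>. X k n \<omega> \<partial>M) \<le> ennreal (4 * t * R k)) sequentially"
        using eventually_gt_at_top [of 0]
      proof eventually_elim
        case (elim n)
        then have "(\<integral>\<^sup>+\<omega>. X k n \<omega> \<partial>M) \<le> ennreal (4 * (real n * (t / real n)) * R k)"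
          unfolding X_def using assms R_pos [of k]
          by (intro brownian_motion3_riemann_exp_moment) auto
        then show ?case
          using elim by simp
      qed
    qed
    also have "\<dots> = ennreal (4 * t * R k)"
      by (simp add: Liminf_const)
    finally show ?thesis .
  qed
  have q: "0 < q" "q \<le> 1 / 2"
  proof -
    have "1 \<le> t / (432 * \<rho>)"
      using assms by (simp add: divide_simps)
    then have "q \<le> exp (- 1)"
      by (simp add: q_def)
    also have "\<dots> \<le> 1 / 2"
      using exp_ge_add_one_self [of 1] by (simp add: exp_minus divide_simps)
    finally show "q \<le> 1 / 2" .
  qed (simp add: q_def)
  \<comment> \<open>As \<open>t \<ge> 1\<close>, the inverse square of \<open>R k\<close> is at most
    \<open>(216 * y k) ^ 4\<close>, which half of the exponential absorbs. Then
    \<open>Suc k \<le> 2 ^ k\<close> turns the doubly exponential decay in \<open>k\<close> into a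
    geometric series with ratio \<open>q \<le> 1 / 2\<close>.\<close>
  have term_le: "4 * t * R k / c k \<le> C * t * q ^ Suc k" for k
  proof -
    have y_eq: "216 * y k = t * (1 / (\<rho> / 2 ^ k))"
      using assms by (simp add: y_def)
    have "1 / (R k)\<^sup>2 = (1 / (\<rho> / 2 ^ k)) ^ 4"
      by (simp only: R_def power_one_over flip: power_mult) simp
    also have "\<dots> \<le> (216 * y k) ^ 4"
      unfolding y_eq using assms by (intro power_mono) (auto simp: divide_simps)
    finally have "1 / (R k)\<^sup>2 \<le> 216 ^ 4 * y k ^ 4"
      by (simp add: power_mult_distrib)
    then have "1 / (R k)\<^sup>2 / (exp (y k) - 1) \<le> 216 ^ 4 * y k ^ 4 / (exp (y k) - 1)"
      using y_pos [of k] by (intro divide_right_mono) auto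
    also have "\<dots> = 216 ^ 4 * (y k ^ 4 / (exp (y k) - 1))"
      by simp
    also have "\<dots> \<le> 216 ^ 4 * (4096 * exp (- y k / 2))"
      by (intro mult_left_mono power4_div_exp_minus_one_le y_pos) auto
    also have "\<dots> \<le> 216 ^ 4 * (4096 * q ^ Suc k)"
    proof -
      have "real (Suc k) \<le> 2 ^ k"
        using Suc_leI [OF less_exp [of k]] by (metis of_nat_le_iff of_nat_numeral of_nat_power)
      then have "real (Suc k) * (t / (432 * \<rho>)) \<le> 2 ^ k * (t / (432 * \<rho>))"
        using assms by (intro mult_right_mono) auto
      also have "\<dots> = y k / 2"
        by (simp add: y_def)
      finally have "exp (- y k / 2) \<le> exp (real (Suc k) * (- (t / (432 * \<rho>))))"
        by simp
      also have "\<dots> = q ^ Suc k"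
        unfolding q_def by (rule exp_of_nat_mult)
      finally show ?thesis by simp
    qed
    finally have "4 * t * (1 / (R k)\<^sup>2 / (exp (y k) - 1)) \<le> 4 * t * (216 ^ 4 * (4096 * q ^ Suc k))"
      using assms by (intro mult_left_mono) auto
    moreover have "4 * t * R k / c k = 4 * t * (1 / (R k)\<^sup>2 / (exp (y k) - 1))"
      using R_pos [of k] by (simp add: c_def power2_eq_square power3_eq_cube)
    ultimately show ?thesis
      by (simp add: C_def)
  qed
  have "(\<integral>\<^sup>+\<omega>. Y \<omega> \<partial>M) = (\<Sum>k. ennreal (1 / c k) * (\<integral>\<^sup>+\<omega>. L k \<omega> \<partial>M))"
    unfolding Y_def by (simp add: nn_integral_suminf nn_integral_cmult)
  also have "\<dots> \<le> (\<Sum>k. ennreal (C * t * q ^ Suc k))"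
  proof (intro suminf_le summableI)
    fix k
    have "ennreal (1 / c k) * (\<integral>\<^sup>+\<omega>. L k \<omega> \<partial>M) \<le> ennreal (1 / c k) * ennreal (4 * t * R k)"
      by (intro mult_left_mono int_L) auto
    also have "\<dots> = ennreal (4 * t * R k / c k)"
      using c_pos [of k] R_pos [of k] assms by (simp flip: ennreal_mult)
    also have "\<dots> \<le> ennreal (C * t * q ^ Suc k)"
      by (intro ennreal_leI term_le)
    finally show "ennreal (1 / c k) * (\<integral>\<^sup>+\<omega>. L k \<omega> \<partial>M) \<le> ennreal (C * t * q ^ Suc k)" .
  qed
  also have "\<dots> = ennreal (C * t * q * (1 / (1 - q)))"
  proof (rule suminf_ennreal_eq)
    show "(\<lambda>k. C * t * q ^ Suc k) sums (C * t * q * (1 / (1 - q)))"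
      using sums_mult [OF geometric_sums [of q], of "C * t * q"] q by (simp add: mult.assoc)
    show "0 \<le> C * t * q ^ Suc k" for k
      using assms q by (simp add: C_def)
  qed
  also have "\<dots> \<le> ennreal (C * t * q * 2)"
  proof (intro ennreal_leI mult_left_mono)
    show "1 / (1 - q) \<le> 2"
      using q by (simp add: divide_simps)
    show "0 \<le> C * t * q"
      using assms q by (simp add: C_def)
  qed
  finally have int_Y: "(\<integral>\<^sup>+\<omega>. Y \<omega> \<partial>M) \<le> ennreal (C * t * q * 2)" .
  define A where "A = {\<omega> \<in> space M. 1 \<le> Y \<omega>}"
  have A [measurable]: "A \<in> sets M"
    unfolding A_def by measurable
  have "emeasure M A \<le> (\<integral>\<^sup>+\<omega>. Y \<omega> \<partial>M)"
    using nn_integral_Markov_inequality [of Y "space M" M 1]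
    by (simp add: A_def cong: nn_integral_cong)
  then have "emeasure M A \<le> ennreal (C * t * q * 2)"
    using int_Y by (rule order_trans)
  then have measure_A: "measure M A \<le> C * t * q * 2"
    using assms q by (simp add: emeasure_eq_measure C_def)
  \<comment> \<open>Outside \<open>A\<close> the whole series is below 1, so each summand is, and
    every \<open>L k\<close> stays below its threshold.\<close>
  have "emeasure lborel {s \<in> {0..t}. norm (W s \<omega> - z) < R k} \<le> ennreal ((\<rho> / 2 ^ k) ^ 3 * t)"
    if \<omega>: "\<omega> \<in> space M - A" for \<omega> k z
  proof (rule occupation_le_of_riemann_exp)
    show "continuous_on {0..t} (\<lambda>s. W s \<omega>)"
      using \<omega> by (intro continuous_on_subset [OF brownian_motion3D(4) [OF assms(1)]]) auto
    have "Y \<omega> < 1"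
      using \<omega> by (auto simp: A_def not_le)
    then have L_less: "ennreal (1 / c k) * L k \<omega> < 1"
      unfolding Y_def by (rule ennreal_suminf_lessD)
    have "L k \<omega> < ennreal (c k)"
    proof (rule ccontr)
      assume "\<not> L k \<omega> < ennreal (c k)"
      then have "ennreal (1 / c k) * ennreal (c k) \<le> ennreal (1 / c k) * L k \<omega>"
        by (intro mult_left_mono) (auto simp: not_less)
      moreover have "ennreal (1 / c k) * ennreal (c k) = 1"
        using c_pos [of k] by (simp flip: ennreal_mult)
      ultimately have "1 \<le> ennreal (1 / c k) * L k \<omega>"
        by (simp only:)
      with L_less show False
        by (rule leD [THEN notE, rotated])
    qed
    moreover have "(\<rho> / 2 ^ k) ^ 3 * t / (216 * (R k)\<^sup>2) = y k"
      using assms by (simp add: R_def y_def field_simps power2_eq_square power3_eq_cube)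
    ultimately show "liminf (\<lambda>n. \<integral>\<^sup>+x. ennreal (exp (\<Sum>j<n. t / real n * bump (R k) (x + W (real j * (t / real n)) \<omega>)) - 1) \<partial>lborel)
        < ennreal (R k ^ 3 * (exp ((\<rho> / 2 ^ k) ^ 3 * t / (216 * (R k)\<^sup>2)) - 1))"
      by (simp only: L_def X_def c_def)
  qed (use assms R_pos in auto)
  with A measure_A show thesis
    by (intro that [of A]) (auto simp: R_def C_def q_def)
qed

section \<open>From the tail bound to the exponential rate\<close>

lemma outer_prob_le_measure:
  assumes "A \<in> sets M" "S \<subseteq> A"
  shows "outer_prob M S \<le> measure M A"
  unfolding outer_prob_def using assms by (intro cInf_lower) (auto intro!: bdd_belowI [of _ 0])

lemma elog_mono: "p \<le> q \<Longrightarrow> q > 0 \<Longrightarrow> elog p \<le> ereal (ln q)"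
  by (simp add: elog_def)

theorem theorem1p3:
  fixes M :: "'a measure" and W :: "real \<Rightarrow> 'a \<Rightarrow> real^3" and b :: real
  assumes "brownian_motion3 M W" and "b > 0"
  shows "((\<lambda>\<delta>::real. Limsup at_top (\<lambda>t::real. ereal (1 / t) *
            elog (outer_prob M {\<omega> \<in> space M.
              (SUP x1 :: real^3. SUP x2 \<in> {x2 :: real^3. dist x1 x2 \<le> \<delta>}.
                 ereal \<bar>Lambda W t \<omega> x1 - Lambda W t \<omega> x2\<bar>) \<ge> ereal b})))
          \<longlongrightarrow> -\<infinity>) (at_right 0)"
  unfolding tendsto_MInfty
proof
  fix r :: real
  \<comment> \<open>The first bound keeps the singular contribution \<open>16 * \<rho>\<close> below
    \<open>b / 2\<close>; the second makes the rate \<open>1 / (432 * \<rho>)\<close> at least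
    \<open>\<bar>r\<bar> + 3\<close>.\<close>
  define \<rho> where "\<rho> = min (b / 64) (1 / (432 * (\<bar>r\<bar> + 3)))"
  have \<rho>: "0 < \<rho>" "16 * \<rho> < b / 2"
    using \<open>b > 0\<close> by (auto simp: \<rho>_def)
  have \<rho>_le: "\<rho> \<le> 1 / (432 * (\<bar>r\<bar> + 3))"
    by (simp add: \<rho>_def)
  also have "\<dots> \<le> 1 / 432"
    by (intro divide_left_mono) auto
  finally have "\<rho> \<le> 1 / 432" .
  have rate: "\<bar>r\<bar> + 3 \<le> 1 / (432 * \<rho>)"
    using \<rho>_le \<rho>(1) by (simp add: divide_simps split: if_splits) (simp add: algebra_simps)
  define C :: real where "C = 8 * 216 ^ 4 * 4096"
  have "C > 0"
    by (simp add: C_def)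
  let ?S = "\<lambda>\<delta> t. {\<omega> \<in> space M.
              (SUP x1 :: real^3. SUP x2 \<in> {x2 :: real^3. dist x1 x2 \<le> \<delta>}.
                 ereal \<bar>Lambda W t \<omega> x1 - Lambda W t \<omega> x2\<bar>) \<ge> ereal b}"
  \<comment> \<open>The bound on \<open>\<delta>\<close> keeps the Lipschitz contribution
    \<open>\<delta> / \<rho> ^ 4\<close> below the other half of \<open>b\<close>.\<close>
  have "Limsup at_top (\<lambda>t. ereal (1 / t) * elog (outer_prob M (?S \<delta> t))) < ereal r"
    if \<delta>: "0 < \<delta>" "\<delta> < b / 2 * \<rho> ^ 4" for \<delta>
  proof -
    have "((\<lambda>t. ln (C * t) / t) \<longlongrightarrow> 0) at_top"
      using \<open>C > 0\<close> by real_asymp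
    then have "eventually (\<lambda>t. ln (C * t) / t < 1) at_top"
      by (rule order_tendstoD) simp
    \<comment> \<open>The prefactor \<open>C * t\<close> costs less than 1 in the rate. Aiming at
      \<open>r - 1\<close> keeps the inequality strict after passing to the limsup.\<close>
    then have "eventually (\<lambda>t. ereal (1 / t) * elog (outer_prob M (?S \<delta> t)) \<le> ereal (r - 1)) at_top"
      using eventually_ge_at_top [of 1]
    proof eventually_elim
      case (elim t)
      obtain A where A: "A \<in> sets M" "measure M A \<le> C * t * exp (- (t / (432 * \<rho>)))"
        and occ: "\<And>\<omega> k z. \<omega> \<in> space M - A \<Longrightarrow>
          emeasure lborel {s \<in> {0..t}. norm (W s \<omega> - z) < (\<rho> / 2 ^ k)\<^sup>2} \<le> ennreal ((\<rho> / 2 ^ k) ^ 3 * t)"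
        by (rule brownian_motion3_occupation_tail [OF assms(1) \<rho>(1) \<open>\<rho> \<le> 1 / 432\<close> elim(2), folded C_def])
          (rule that)
      \<comment> \<open>The event with the double supremum is never shown measurable; covering it by
        the measurable set \<open>A\<close> bounds its outer probability.\<close>
      have "?S \<delta> t \<subseteq> A"
      proof (rule subsetI, rule ccontr)
        fix \<omega>
        assume \<omega>: "\<omega> \<in> ?S \<delta> t" and "\<omega> \<notin> A"
        then have "\<omega> \<in> space M - A" by simp
        have "ereal \<bar>Lambda W t \<omega> x1 - Lambda W t \<omega> x2\<bar> \<le> ereal (16 * \<rho> + \<delta> / \<rho> ^ 4)"
          if "dist x1 x2 \<le> \<delta>" for x1 x2
        proof -
          have "continuous_on {0..t} (\<lambda>s. W s \<omega>)"
            using \<omega> by (intro continuous_on_subset [OF brownian_motion3D(4) [OF assms(1)]]) auto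
          then have "\<bar>Lambda W t \<omega> x1 - Lambda W t \<omega> x2\<bar> \<le> 16 * \<rho> + \<delta> / \<rho> ^ 4"
            using elim \<rho>(1) occ [OF \<open>\<omega> \<in> space M - A\<close>] that by (intro Lambda_diff_le) auto
          then show ?thesis by simp
        qed
        then have "(SUP x1 :: real^3. SUP x2 \<in> {x2 :: real^3. dist x1 x2 \<le> \<delta>}.
            ereal \<bar>Lambda W t \<omega> x1 - Lambda W t \<omega> x2\<bar>) \<le> ereal (16 * \<rho> + \<delta> / \<rho> ^ 4)"
          by (intro SUP_least) auto
        with \<omega> have "ereal b \<le> ereal (16 * \<rho> + \<delta> / \<rho> ^ 4)"
          unfolding mem_Collect_eq by (elim conjE) (rule order_trans)
        moreover have "\<delta> / \<rho> ^ 4 < b / 2"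
          using \<rho>(1) \<delta>(2) by (simp add: pos_divide_less_eq)
        ultimately show False
          using \<rho>(2) by simp
      qed
      then have "outer_prob M (?S \<delta> t) \<le> C * t * exp (- (t / (432 * \<rho>)))"
        by (rule order_trans [OF outer_prob_le_measure [OF A(1)] A(2)])
      then have "elog (outer_prob M (?S \<delta> t)) \<le> ereal (ln (C * t * exp (- (t / (432 * \<rho>)))))"
        using \<open>C > 0\<close> elim by (intro elog_mono) auto
      then have "ereal (1 / t) * elog (outer_prob M (?S \<delta> t))
          \<le> ereal (1 / t) * ereal (ln (C * t * exp (- (t / (432 * \<rho>)))))"
        using elim by (intro ereal_mult_left_mono) auto
      also have "\<dots> = ereal (ln (C * t) / t - 1 / (432 * \<rho>))"
        using \<open>C > 0\<close> elim \<rho>(1) by (simp add: ln_mult) (simp add: field_simps)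
      also have "\<dots> \<le> ereal (r - 1)"
        unfolding ereal_less_eq using elim(1) rate by linarith
      finally show ?case .
    qed
    then have "Limsup at_top (\<lambda>t. ereal (1 / t) * elog (outer_prob M (?S \<delta> t))) \<le> ereal (r - 1)"
      by (rule Limsup_bounded)
    also have "\<dots> < ereal r"
      by simp
    finally show ?thesis .
  qed
  moreover have "eventually (\<lambda>\<delta>. 0 < \<delta> \<and> \<delta> < b / 2 * \<rho> ^ 4) (at_right 0)"
    unfolding eventually_at_right_field using \<open>b > 0\<close> \<rho>(1) by (intro exI [of _ "b / 2 * \<rho> ^ 4"]) auto
  ultimately show "eventually (\<lambda>\<delta>. Limsup at_top (\<lambda>t. ereal (1 / t) * elog (outer_prob M (?S \<delta> t))) < ereal r)
      (at_right 0)"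
    by (auto elim: eventually_mono)
qed

end
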